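(* Let $n\geq 4$, and let $G$ be an $n$-vertex graph with minimum degree $\delta(G)\geq n-3$. Then $$\operatorname{rig}(G)\geq\mathsf{M}(G)-\left\lceil\sigma(\overline G)/2\right\rceil,$$ where $\overline G$ is the complement of $G$.
   Context: All graphs are finite and simple. A $d$-dimensional framework $(G,p)$ of a graph $G=(V,E)$ is given by a map $p:V\to\mathbb{R}^d$. It is rigid if every continuous motion of the vertices (starting at $p$) preserving the lengths of all edges preserves all pairwise distances between vertices. The map $p$ is generic if the $d|V|$ coordinates of the points $p(v)$, $v\in V$, are algebraically independent over $\mathbb{Q}$. $G$ is (generically) $d$-rigid if $(G,p)$ is rigid for some, equivalently every, generic $p:V\to\mathbb{R}^d$. Equivalently: either $G$ is a complete graph on at most $d+1$ vertices, or $|V|\ge d+1$ and for generic $p$ the rigidity matrix $R(G,p)$ has rank $d|V|-\binom{d+1}{2}$. Here $R(G,p)$ is the $|E|\times d|V|$ matrix whose row for the edge $uv$ has $p(u)-p(v)$ in the $d$ columns of $u$, $p(v)-p(u)$ in the $d$ columns of $v$, and zeros elsewhere. By convention every graph is $0$-rigid. For an $n$-vertex graph $G$, the rigidity dimension $\operatorname{rig}(G)$ is the largest nonnegative integer $d\le n-1$ for which $G$ is generically $d$-rigid. The Maxwell dimension $\mathsf{M}(G)$ is the largest nonnegative integer $d\le n-1$ satisfying $dn-\binom{d+1}{2}\le |E(G)|$. For a graph $F$, a set $S\subseteq V(F)$ is admissible if $F-S$ has maximum degree at most two and has no connected component isomorphic to the cycle $C_3$ or $C_4$. Define $\sigma(F)=\min\{|S|:S\subseteq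 V(F)\text{ is admissible}\}$. *)

theory Defs
  imports "HOL-Analysis.Analysis" "HOL-Library.Poly_Mapping"
begin

section \<open>Finite simple graphs\<close>

record 'a sgraph =
  verts :: "'a set"
  edges :: "'a set set"

definition simple_graph :: "'a sgraph \<Rightarrow> bool" where
  "simple_graph G \<longleftrightarrow>
     finite (verts G) \<and> (\<forall>e\<in>edges G. e \<subseteq> verts G \<and> card e = 2)"

definition adj :: "'a sgraph \<Rightarrow> 'a \<Rightarrow> 'a \<Rightarrow> bool" where
  "adj G u v \<longleftrightarrow> {u, v} \<in> edges G"

definition degree :: "'a sgraph \<Rightarrow> 'a \<Rightarrow> nat" where
  "degree G v = card {e \<in> edges G. v \<in> e}"

definition min_degree :: "'a sgraph \<Rightarrow> nat" where
  "min_degree G = Min (degree G ` verts G)"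

definition complement :: "'a sgraph \<Rightarrow> 'a sgraph" where
  "complement G =
     \<lparr>verts = verts G,
      edges = {{u, v} | u v. u \<in> verts G \<and> v \<in> verts G \<and> u \<noteq> v \<and> {u, v} \<notin> edges G}\<rparr>"

definition induced :: "'a sgraph \<Rightarrow> 'a set \<Rightarrow> 'a sgraph" where
  "induced G U = \<lparr>verts = verts G \<inter> U, edges = {e \<in> edges G. e \<subseteq> U}\<rparr>"

definition remove_verts :: "'a sgraph \<Rightarrow> 'a set \<Rightarrow> 'a sgraph" where
  "remove_verts G S = induced G (verts G - S)"

definition components :: "'a sgraph \<Rightarrow> 'a sgraph set" where
  "components G = {induced G {w. (adj G)\<^sup>*\<^sup>* v w} | v. v \<in> verts G}"

definition isomorphic :: "'a sgraph \<Rightarrow> 'b sgraph \<Rightarrow> bool" where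
  "isomorphic G H \<longleftrightarrow>
     (\<exists>f. bij_betw f (verts G) (verts H) \<and>
          (\<forall>u\<in>verts G. \<forall>v\<in>verts G. adj G u v \<longleftrightarrow> adj H (f u) (f v)))"

text \<open>The cycle on \<open>k\<close> vertices, for \<open>k \<ge> 3\<close>.\<close>
definition cycle_graph :: "nat \<Rightarrow> nat sgraph" where
  "cycle_graph k = \<lparr>verts = {..<k}, edges = {{i, Suc i mod k} | i. i < k}\<rparr>"

section \<open>Admissible sets\<close>

definition admissible :: "'a sgraph \<Rightarrow> 'a set \<Rightarrow> bool" where
  "admissible F S \<longleftrightarrow>
     S \<subseteq> verts F \<and>
     (\<forall>v\<in>verts (remove_verts F S). degree (remove_verts F S) v \<le> 2) \<and>
     (\<forall>C\<in>components (remove_verts F S).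
        \<not> isomorphic C (cycle_graph 3) \<and> \<not> isomorphic C (cycle_graph 4))"

definition sigma :: "'a sgraph \<Rightarrow> nat" where
  "sigma F = Min {card S | S. admissible F S}"

section \<open>Algebraic independence\<close>

text \<open>
  A polynomial over \<open>\<rat>\<close> in variables indexed by \<open>'i\<close> is a finitely supported map from
  monomials to coefficients, a monomial being a finitely supported map from variables to
  exponents.
\<close>
type_synonym 'i rat_mpoly = "('i \<Rightarrow>\<^sub>0 nat) \<Rightarrow>\<^sub>0 rat"

definition mpoly_vars :: "'i rat_mpoly \<Rightarrow> 'i set" where
  "mpoly_vars P = (\<Union>m\<in>Poly_Mapping.keys P. Poly_Mapping.keys m)"

definition mpoly_eval :: "('i \<Rightarrow> real) \<Rightarrow> 'i rat_mpoly \<Rightarrow> real" where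
  "mpoly_eval x P =
     (\<Sum>m\<in>Poly_Mapping.keys P. of_rat (Poly_Mapping.lookup P m) *
        (\<Prod>i\<in>Poly_Mapping.keys m. x i ^ Poly_Mapping.lookup m i))"

definition alg_independent :: "'i set \<Rightarrow> ('i \<Rightarrow> real) \<Rightarrow> bool" where
  "alg_independent I x \<longleftrightarrow>
     (\<forall>P. mpoly_vars P \<subseteq> I \<and> mpoly_eval x P = 0 \<longrightarrow> P = 0)"

section \<open>Frameworks and rigidity\<close>

text \<open>
  The dimension \<open>d\<close> varies, so a map into \<open>\<real>\<^sup>d\<close> is represented as \<open>p :: 'a \<Rightarrow> nat \<Rightarrow> real\<close>, where
  \<open>p v i\<close> with \<open>i < d\<close> are the coordinates of the point of \<open>v\<close>. Values of \<open>p\<close> outside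
  \<open>verts G\<close> or at indices \<open>i \<ge> d\<close> are irrelevant in everything that follows.
\<close>
type_synonym 'a config = "'a \<Rightarrow> nat \<Rightarrow> real"

definition edist :: "nat \<Rightarrow> (nat \<Rightarrow> real) \<Rightarrow> (nat \<Rightarrow> real) \<Rightarrow> real" where
  "edist d x y = L2_set (\<lambda>i. x i - y i) {..<d}"

definition continuous_motion ::
    "nat \<Rightarrow> 'a sgraph \<Rightarrow> 'a config \<Rightarrow> (real \<Rightarrow> 'a config) \<Rightarrow> bool" where
  "continuous_motion d G p q \<longleftrightarrow>
     (\<forall>v\<in>verts G. \<forall>i<d. continuous_on {0..1} (\<lambda>t. q t v i) \<and> q 0 v i = p v i)"

definition rigid :: "nat \<Rightarrow> 'a sgraph \<Rightarrow> 'a config \<Rightarrow> bool" where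
  "rigid d G p \<longleftrightarrow>
     (\<forall>q. continuous_motion d G p q \<and>
          (\<forall>t\<in>{0..1}. \<forall>u v. {u, v} \<in> edges G \<longrightarrow> edist d (q t u) (q t v) = edist d (p u) (p v))
        \<longrightarrow> (\<forall>t\<in>{0..1}. \<forall>u\<in>verts G. \<forall>v\<in>verts G.
               edist d (q t u) (q t v) = edist d (p u) (p v)))"

definition generic :: "nat \<Rightarrow> 'a sgraph \<Rightarrow> 'a config \<Rightarrow> bool" where
  "generic d G p \<longleftrightarrow> alg_independent (verts G \<times> {..<d}) (\<lambda>(v, i). p v i)"

definition generically_rigid :: "nat \<Rightarrow> 'a sgraph \<Rightarrow> bool" where
  "generically_rigid d G \<longleftrightarrow> (\<exists>p. generic d G p \<and> rigid d G p)"

text \<open>The convention that every graph is \<open>0\<close>-rigid needs no separate clause.\<close>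
lemma generically_rigid_0: "generically_rigid 0 G"
proof -
  have "P = 0" if "mpoly_vars P \<subseteq> {}" "mpoly_eval x P = 0"
    for P :: "('a \<times> nat) rat_mpoly" and x
  proof (rule ccontr)
    assume "P \<noteq> 0"
    moreover have "Poly_Mapping.keys P \<subseteq> {0}"
      using that(1) by (auto simp: mpoly_vars_def)
    ultimately have "Poly_Mapping.keys P = {0}"
      by (metis keys_eq_empty subset_singletonD)
    then show False
      using that(2) by (simp add: mpoly_eval_def flip: not_in_keys_iff_lookup_eq_zero)
  qed
  then have "generic 0 G p" for p
    by (auto simp: generic_def alg_independent_def)
  then show ?thesis
    by (auto simp: generically_rigid_def rigid_def edist_def)
qed

definition rigidity_dim :: "'a sgraph \<Rightarrow> nat" where
  "rigidity_dim G = Max {d. d \<le> card (verts G) - 1 \<and> generically_rigid d G}"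

definition maxwell_dim :: "'a sgraph \<Rightarrow> nat" where
  "maxwell_dim G =
     Max {d. d \<le> card (verts G) - 1 \<and>
             int d * int (card (verts G)) - int ((d + 1) choose 2) \<le> int (card (edges G))}"

end

theory Submission
  imports Defs
begin

text \<open>
  Write \<open>F\<close> for the edge set of the complement, so that \<open>F\<close> has maximum degree at most two, and
  \<open>k = n - 1 - d\<close>. The Maxwell inequality in dimension \<open>d\<close> says \<open>card F \<le> Suc k choose 2\<close>, the
  dimension of the space of quadratic forms in \<open>k\<close> variables.

  By Gale duality, infinitesimal rigidity of \<open>K\<^sub>n - F\<close> in dimension \<open>d\<close> amounts to finding
  vectors \<open>q v\<close> in dimension \<open>k\<close> for which the products \<open>q u q v\<close>, \<open>{u, v} \<in> F\<close>, are linearly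
  independent quadratic forms. These are built by induction on \<open>k\<close>: send a
  well-separated set \<open>A\<close> of vertices meeting at most \<open>k\<close> edges to the last unit vector; the edges
  meeting \<open>A\<close> then become independent multiples of the last variable, and the remaining edges live
  in dimension \<open>k - 1\<close>. Such a set meeting exactly the required number of edges always exists, except
  that parity can fail when \<open>F\<close> consists of triangles only. If \<open>\<sigma> = 0\<close> there are no
  triangles; if \<open>\<sigma> > 0\<close> one dimension may be given away, which removes the parity constraint.

  Along a motion, two configurations \<open>p, p'\<close> with the same edge lengths have the infinitesimal
  motion \<open>p - p'\<close> at their midpoint, so a neighbourhood of infinitesimally rigid configurations
  forces all distances to be locally constant. All conditions used are open, hence are met
  by generic configurations.
\<close>

section \<open>Interpolation by linear and quadratic forms\<close>

text \<open>Dual form of linear independence of the vectors \<open>q w\<close> in the coordinates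
  \<open>S\<close>. The family is indexed by \<open>W\<close>, so equal vectors at different indices
  count as dependent.\<close>

definition lininterp :: "'i set \<Rightarrow> 'w set \<Rightarrow> ('w \<Rightarrow> 'i \<Rightarrow> real) \<Rightarrow> bool" where
  "lininterp S W q \<longleftrightarrow> (\<forall>g. \<exists>l. \<forall>w\<in>W. (\<Sum>i\<in>S. l i * q w i) = g w)"

lemma lininterp_dual:
  assumes "lininterp S W q"
  obtains L where "\<And>v w. w \<in> W \<Longrightarrow> (\<Sum>i\<in>S. L v i * q w i) = (if w = v then 1 else 0)"
proof -
  have "\<forall>v. \<exists>l. \<forall>w\<in>W. (\<Sum>i\<in>S. l i * q w i) = (if w = v then 1 else 0)"
    using assms unfolding lininterp_def by (intro allI) (erule allE, assumption)
  from choice[OF this] that show ?thesis by blast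
qed

text \<open>A multiple of \<open>l0\<close> corrects the value at \<open>x\<close> without
  disturbing the values on \<open>W\<close>.\<close>

lemma lininterp_insert:
  assumes "lininterp S W q" "\<And>w. w \<in> W \<Longrightarrow> (\<Sum>i\<in>S. l0 i * q w i) = 0" "(\<Sum>i\<in>S. l0 i * q x i) \<noteq> 0"
  shows "lininterp S (insert x W) q"
  unfolding lininterp_def
proof
  fix g
  obtain l where l: "\<And>w. w \<in> W \<Longrightarrow> (\<Sum>i\<in>S. l i * q w i) = g w"
    using assms(1) unfolding lininterp_def by metis
  define c where "c = (g x - (\<Sum>i\<in>S. l i * q x i)) / (\<Sum>i\<in>S. l0 i * q x i)"
  have *: "(\<Sum>i\<in>S. (l i + c * l0 i) * q w i) = (\<Sum>i\<in>S. l i * q w i) + c * (\<Sum>i\<in>S. l0 i * q w i)" for w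
    by (simp add: distrib_right sum.distrib sum_distrib_left mult.assoc)
  have "\<forall>w\<in>insert x W. (\<Sum>i\<in>S. (l i + c * l0 i) * q w i) = g w"
    unfolding * using assms(2,3) l by (auto simp: c_def)
  then show "\<exists>l. \<forall>w\<in>insert x W. (\<Sum>i\<in>S. l i * q w i) = g w" by (intro exI)
qed

text \<open>Induction on \<open>W\<close>. If every functional vanishing on the old vectors also
  vanishes at \<open>x\<close>, then duality expands \<open>q x\<close> in them, which is a relation
  with coefficient 1 at \<open>x\<close>.\<close>

lemma lininterpI_indep:
  assumes "finite S" "finite W"
    "\<And>C. (\<And>i. i \<in> S \<Longrightarrow> (\<Sum>w\<in>W. C w * q w i) = 0) \<Longrightarrow> (\<forall>w\<in>W. C w = 0)"
  shows "lininterp S W q"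
  using assms(2,3)
proof (induction W)
  case empty
  then show ?case by (simp add: lininterp_def)
next
  case (insert x W)
  have IH: "lininterp S W q"
  proof (rule insert.IH)
    fix C assume C: "\<And>i. i \<in> S \<Longrightarrow> (\<Sum>w\<in>W. C w * q w i) = 0"
    have "(\<Sum>w\<in>insert x W. (C(x := 0)) w * q w i) = (\<Sum>w\<in>W. C w * q w i)" for i
      using insert.hyps by (simp, intro sum.cong) auto
    then have "\<forall>w\<in>insert x W. (C(x := 0)) w = 0"
      using C by (intro insert.prems) auto
    then show "\<forall>w\<in>W. C w = 0" using insert.hyps by (metis fun_upd_apply insertI2)
  qed
  show ?case
  proof (cases "\<exists>l0. (\<forall>w\<in>W. (\<Sum>i\<in>S. l0 i * q w i) = 0) \<and> (\<Sum>i\<in>S. l0 i * q x i) \<noteq> 0")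
    case True
    then show ?thesis using lininterp_insert[OF IH] by blast
  next
    case False
    obtain L where L: "\<And>v w. w \<in> W \<Longrightarrow> (\<Sum>i\<in>S. L v i * q w i) = (if w = v then 1 else 0)"
      using lininterp_dual[OF IH] by blast
    \<comment> \<open>The dual functionals \<open>L w\<close> read off the coefficients of
      \<open>q x\<close> in its expansion.\<close>
    define C where "C w = (if w = x then 1 else - (\<Sum>j\<in>S. L w j * q x j))" for w
    have CW: "C w = - (\<Sum>j\<in>S. L w j * q x j)" if "w \<in> W" for w
      using that insert.hyps by (auto simp: C_def)
    have "(\<Sum>w\<in>insert x W. C w * q w i) = 0" if i: "i \<in> S" for i
    proof -
      \<comment> \<open>Coordinate \<open>i\<close> minus its interpolant on \<open>W\<close>: it
        vanishes on \<open>W\<close>, hence at \<open>x\<close> by the case assumption.\<close>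
      define l where "l j = (if j = i then 1 else 0) - (\<Sum>v\<in>W. q v i * L v j)" for j
      have ev: "(\<Sum>j\<in>S. l j * q w j) = q w i - (\<Sum>v\<in>W. q v i * (\<Sum>j\<in>S. L v j * q w j))" for w
      proof -
        have "(\<Sum>j\<in>S. l j * q w j) = (\<Sum>j\<in>S. (if j = i then q w j else 0)) - (\<Sum>j\<in>S. \<Sum>v\<in>W. q v i * (L v j * q w j))"
          unfolding sum_subtractf[symmetric]
          by (intro sum.cong) (auto simp: l_def algebra_simps sum_distrib_left sum_distrib_right)
        also have "(\<Sum>j\<in>S. \<Sum>v\<in>W. q v i * (L v j * q w j)) = (\<Sum>v\<in>W. q v i * (\<Sum>j\<in>S. L v j * q w j))"
          by (subst sum.swap) (simp add: sum_distrib_left)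
        finally show ?thesis using i assms(1) by simp
      qed
      have "(\<Sum>j\<in>S. l j * q w j) = 0" if "w \<in> W" for w
      proof -
        have "(\<Sum>v\<in>W. q v i * (\<Sum>j\<in>S. L v j * q w j)) = (\<Sum>v\<in>W. if w = v then q v i else 0)"
          by (intro sum.cong) (auto simp: L that)
        then show ?thesis unfolding ev using that insert.hyps by simp
      qed
      then have "(\<Sum>j\<in>S. l j * q x j) = 0" using False by blast
      then have "q x i = (\<Sum>v\<in>W. q v i * (\<Sum>j\<in>S. L v j * q x j))" by (simp add: ev)
      moreover have "(\<Sum>w\<in>W. C w * q w i) = - (\<Sum>v\<in>W. q v i * (\<Sum>j\<in>S. L v j * q x j))"
        unfolding sum_negf[symmetric] by (intro sum.cong) (auto simp: CW)
      ultimately show ?thesis using insert.hyps by (simp add: C_def)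
    qed
    then have "C x = 0" using insert.prems by blast
    then show ?thesis by (simp add: C_def)
  qed
qed

lemma lininterp_card_le:
  assumes "finite S" "finite W" "lininterp S W q"
  shows "card W \<le> card S"
  using assms
proof (induction S arbitrary: W q rule: finite_induct)
  case empty
  have "W = {}"
  proof -
    have "\<exists>l. \<forall>w\<in>W. (\<Sum>i\<in>{}. l i * q w i) = (1::real)"
      using empty(2) unfolding lininterp_def by (rule spec)
    then show ?thesis by auto
  qed
  then show ?case by simp
next
  case (insert s S)
  show ?case
  proof (cases "\<forall>w\<in>W. q w s = 0")
    case True
    then have "lininterp S W q"
      using insert.prems insert.hyps by (simp add: lininterp_def)
    then show ?thesis using insert.IH[of W q] insert.prems insert.hyps by simp
  next
    case False
    then obtain w1 where w1: "w1 \<in> W" "q w1 s \<noteq> 0" by blast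
    define q' where "q' w i = q w i - q w s / q w1 s * q w1 i" for w i
    have "lininterp S (W - {w1}) q'"
      unfolding lininterp_def
    proof
      fix g
      \<comment> \<open>The value 0 at the pivot makes the multiple of \<open>q w1\<close>
        subtracted in \<open>q'\<close> contribute nothing.\<close>
      have "\<exists>l. \<forall>w\<in>W. (\<Sum>i\<in>insert s S. l i * q w i) = (if w = w1 then 0 else g w)"
        using insert.prems(2) unfolding lininterp_def by (rule spec)
      then obtain l where l: "\<And>w. w \<in> W \<Longrightarrow> (\<Sum>i\<in>insert s S. l i * q w i) = (if w = w1 then 0 else g w)"
        by blast
      have "(\<Sum>i\<in>S. l i * q' w i) = g w" if "w \<in> W - {w1}" for w
      proof -
        have "(\<Sum>i\<in>S. l i * q' w i) = (\<Sum>i\<in>insert s S. l i * q' w i)"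
          using insert.hyps w1 by (simp add: q'_def)
        also have "\<dots> = (\<Sum>i\<in>insert s S. l i * q w i) - q w s / q w1 s * (\<Sum>i\<in>insert s S. l i * q w1 i)"
          unfolding sum_distrib_left sum_subtractf[symmetric]
          by (intro sum.cong) (auto simp: q'_def algebra_simps)
        also have "\<dots> = g w" using that w1 l by simp
        finally show ?thesis .
      qed
      then show "\<exists>l. \<forall>w\<in>W - {w1}. (\<Sum>i\<in>S. l i * q' w i) = g w" by blast
    qed
    then have "card (W - {w1}) \<le> card S" using insert.IH insert.prems by simp
    then show ?thesis using w1 insert.prems insert.hyps by simp
  qed
qed

text \<open>Transpose: \<open>S\<close> indexes more vectors than there are coordinates in
  \<open>W\<close>, so they satisfy a nontrivial relation, and its coefficients are
  \<open>l\<close>.\<close>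

lemma lininterp_annihilator:
  assumes "finite S" "finite W" "card W < card S"
  obtains l s where "\<And>w. w \<in> W \<Longrightarrow> (\<Sum>i\<in>S. l i * q w i) = 0" "s \<in> S" "l s \<noteq> (0::real)"
proof -
  have "\<not> lininterp W S (\<lambda>i w. q w i)"
    using lininterp_card_le[OF assms(2,1)] assms(3) by fastforce
  then have "\<exists>l. (\<forall>w\<in>W. (\<Sum>i\<in>S. l i * q w i) = 0) \<and> \<not> (\<forall>s\<in>S. l s = 0)"
    using lininterpI_indep[OF assms(2,1), of "\<lambda>i w. q w i"] by blast
  then show ?thesis using that by blast
qed

lemma lininterp_spanning:
  assumes "finite S" "finite W" "card W = card S" "lininterp S W q"
  shows "lininterp W S (\<lambda>i w. q w i)"
proof (rule lininterpI_indep[OF assms(2,1)], rule ballI, rule ccontr)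
  fix l0 s
  assume l0: "\<And>w. w \<in> W \<Longrightarrow> (\<Sum>i\<in>S. l0 i * q w i) = 0" and s: "s \<in> S" "l0 s \<noteq> 0"
  have "lininterp (S - {s}) W q"
    unfolding lininterp_def
  proof
    fix g
    obtain l where l: "\<And>w. w \<in> W \<Longrightarrow> (\<Sum>i\<in>S. l i * q w i) = g w"
      using assms(4) unfolding lininterp_def by metis
    \<comment> \<open>Subtracting a multiple of \<open>l0\<close> changes no value on
      \<open>W\<close> and kills the coefficient at \<open>s\<close>.\<close>
    define l' where "l' i = l i - l s / l0 s * l0 i" for i
    have "(\<Sum>i\<in>S - {s}. l' i * q w i) = g w" if "w \<in> W" for w
    proof -
      have "(\<Sum>i\<in>S - {s}. l' i * q w i) = (\<Sum>i\<in>S. l' i * q w i)"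
        using s assms(1) by (simp add: sum.remove[of S s] l'_def)
      also have "\<dots> = (\<Sum>i\<in>S. l i * q w i) - l s / l0 s * (\<Sum>i\<in>S. l0 i * q w i)"
        unfolding sum_distrib_left sum_subtractf[symmetric]
        by (intro sum.cong) (auto simp: l'_def algebra_simps)
      finally show ?thesis using l l0 that by simp
    qed
    then show "\<exists>l. \<forall>w\<in>W. (\<Sum>i\<in>S - {s}. l i * q w i) = g w" by blast
  qed
  then have "card W \<le> card (S - {s})"
    using assms by (intro lininterp_card_le) auto
  then show False using s assms(1,3) by (metis card_Diff1_less leD)
qed

section \<open>Stability of independence under perturbation\<close>

text \<open>At a largest entry of \<open>c\<close>, the deviation of \<open>T\<close> from the
  identity accounts for at most half of that entry. With \<open>B = 0\<close> this gives injectivity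
  of \<open>T\<close>.\<close>

lemma diag_dominant_bound:
  fixes c :: "'w \<Rightarrow> real"
  assumes W: "finite W"
    and T: "\<And>w w'. w \<in> W \<Longrightarrow> w' \<in> W \<Longrightarrow> \<bar>T w w' - (if w = w' then 1 else 0)\<bar> \<le> 1 / (2 * real (card W))"
    and b: "\<And>w. w \<in> W \<Longrightarrow> \<bar>\<Sum>w'\<in>W. T w w' * c w'\<bar> \<le> B"
    and "v \<in> W"
  shows "\<bar>c v\<bar> \<le> 2 * B"
proof -
  have ne: "W \<noteq> {}" using \<open>v \<in> W\<close> by auto
  define M where "M = Max ((\<lambda>w. \<bar>c w\<bar>) ` W)"
  have "M \<in> (\<lambda>w. \<bar>c w\<bar>) ` W" unfolding M_def using W ne by (intro Max_in) auto
  then obtain w where w: "w \<in> W" "\<bar>c w\<bar> = M" by auto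
  have M: "\<bar>c w'\<bar> \<le> M" if "w' \<in> W" for w' unfolding M_def using W that by simp
  have "c w = (\<Sum>w'\<in>W. if w = w' then c w' else 0)" using w W by simp
  also have "\<dots> = (\<Sum>w'\<in>W. T w w' * c w') - (\<Sum>w'\<in>W. (T w w' - (if w = w' then 1 else 0)) * c w')"
    unfolding sum_subtractf[symmetric] by (intro sum.cong) (auto simp: algebra_simps)
  finally have "\<bar>c w\<bar> \<le> \<bar>\<Sum>w'\<in>W. T w w' * c w'\<bar> + \<bar>\<Sum>w'\<in>W. (T w w' - (if w = w' then 1 else 0)) * c w'\<bar>"
    by linarith
  also have "\<dots> \<le> B + (\<Sum>w'\<in>W. 1 / (2 * real (card W)) * M)"
  proof (intro add_mono b w order.trans[OF sum_abs] sum_mono)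
    fix w' assume "w' \<in> W"
    then show "\<bar>(T w w' - (if w = w' then 1 else 0)) * c w'\<bar> \<le> 1 / (2 * real (card W)) * M"
      unfolding abs_mult using T[OF w(1)] M by (intro mult_mono) auto
  qed
  also have "(\<Sum>w'\<in>W. 1 / (2 * real (card W)) * M) = M / 2"
    using ne W by (simp add: field_simps)
  finally show ?thesis using w M[OF \<open>v \<in> W\<close>] by linarith
qed

text \<open>Independence is an open condition: the functionals dual to the limit vectors, applied to
  the perturbed ones, give a matrix tending to the identity.\<close>

lemma eventually_lininterp:
  assumes "finite S" "finite W" "lininterp S W q"
    and lim: "\<And>w i. w \<in> W \<Longrightarrow> i \<in> S \<Longrightarrow> ((\<lambda>n. q' n w i) \<longlongrightarrow> q w i) Fl"
  shows "eventually (\<lambda>n. lininterp S W (q' n)) Fl"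
proof -
  obtain L where L: "\<And>v w. w \<in> W \<Longrightarrow> (\<Sum>i\<in>S. L v i * q w i) = (if w = v then 1 else 0)"
    using lininterp_dual[OF assms(3)] by blast
  define T where "T n v w = (\<Sum>i\<in>S. L v i * q' n w i)" for n v w
  have "eventually (\<lambda>n. \<bar>T n v w - (if v = w then 1 else 0)\<bar> \<le> 1 / (2 * real (card W))) Fl"
    if "v \<in> W" "w \<in> W" for v w
  proof -
    have "((\<lambda>n. T n v w - (if v = w then 1 else 0)) \<longlongrightarrow> (\<Sum>i\<in>S. L v i * q w i) - (if v = w then 1 else 0)) Fl"
      unfolding T_def using lim that by (intro tendsto_intros) auto
    then have "((\<lambda>n. T n v w - (if v = w then 1 else 0)) \<longlongrightarrow> 0) Fl" using L[OF that(2), of v] by (simp split: if_splits)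
    moreover have "1 / (2 * real (card W)) > 0" using that assms(2) by (simp add: card_gt_0_iff) auto
    ultimately have "eventually (\<lambda>n. dist (T n v w - (if v = w then 1 else 0)) 0 < 1 / (2 * real (card W))) Fl"
      by (rule tendstoD)
    then show ?thesis by eventually_elim (simp add: dist_real_def)
  qed
  then have "eventually (\<lambda>n. \<forall>v\<in>W. \<forall>w\<in>W. \<bar>T n v w - (if v = w then 1 else 0)\<bar> \<le> 1 / (2 * real (card W))) Fl"
    using assms(2) by (simp add: eventually_ball_finite_distrib)
  then show ?thesis
  proof eventually_elim
    case (elim n)
    show ?case
    proof (rule lininterpI_indep[OF assms(1,2)], rule ballI)
      fix C v assume C: "\<And>i. i \<in> S \<Longrightarrow> (\<Sum>w\<in>W. C w * q' n w i) = 0" and v: "v \<in> W"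
      have "(\<Sum>w\<in>W. T n u w * C w) = 0" for u
      proof -
        have "(\<Sum>w\<in>W. T n u w * C w) = (\<Sum>w\<in>W. \<Sum>i\<in>S. L u i * (C w * q' n w i))"
          by (simp add: T_def sum_distrib_right sum_distrib_left algebra_simps)
        also have "\<dots> = (\<Sum>i\<in>S. L u i * (\<Sum>w\<in>W. C w * q' n w i))"
          by (subst sum.swap) (simp add: sum_distrib_left)
        finally show ?thesis using C by simp
      qed
      then have "\<bar>C v\<bar> \<le> 2 * 0"
        using elim v by (intro diag_dominant_bound[OF assms(2), of "T n" C 0]) auto
      then show "C v = 0" by simp
    qed
  qed
qed

text \<open>Vectors are treated one at a time. By dimension some nonzero functional annihilates the
  earlier ones, and changing one coordinate of the next vector leaves its kernel.\<close>

lemma lininterp_perturb: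
  assumes "finite S" "finite W" "card W \<le> card S" "e > 0"
  shows "\<exists>q'. (\<forall>w i. \<bar>q' w i - q w i\<bar> < e) \<and> lininterp S W q'"
  using assms(2,3)
proof (induction W)
  case empty
  show ?case using assms by (intro exI[of _ q]) (auto simp: lininterp_def)
next
  case (insert x W)
  then obtain q' where q': "\<And>w i. \<bar>q' w i - q w i\<bar> < e" "lininterp S W q'"
    by auto
  obtain l s where l: "\<And>w. w \<in> W \<Longrightarrow> (\<Sum>i\<in>S. l i * q' w i) = 0" "s \<in> S" "l s \<noteq> 0"
    using lininterp_annihilator[OF assms(1) insert.hyps(1), of q'] insert by auto
  \<comment> \<open>The nudge is added to the original \<open>q x\<close>, so errors do not
    accumulate; \<open>e / 2\<close> keeps it strictly below \<open>e\<close>.\<close>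
  define r where "r = (if (\<Sum>i\<in>S. l i * q x i) = 0 then e / 2 else 0)"
  define q'' where "q'' = q'(x := (q x)(s := q x s + r))"
  have eq: "(\<Sum>i\<in>S. m i * q'' w i) = (\<Sum>i\<in>S. m i * q' w i)" if "w \<in> W" for w m
    using that insert.hyps by (intro sum.cong) (auto simp: q''_def)
  have "(\<Sum>i\<in>S. l i * q'' x i) = (\<Sum>i\<in>S. l i * q x i + (if i = s then l i * r else 0))"
    by (intro sum.cong) (auto simp: q''_def algebra_simps)
  also have "\<dots> = (\<Sum>i\<in>S. l i * q x i) + l s * r"
    using l assms(1) by (simp add: sum.distrib)
  also have "\<dots> \<noteq> 0" using l assms(4) by (auto simp: r_def)
  finally have "lininterp S (insert x W) q''"
    using q'(2) l(1) by (intro lininterp_insert[where ?l0.0 = l]) (auto simp: lininterp_def eq)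
  moreover have "\<bar>q'' w i - q w i\<bar> < e" for w i
    using q'(1) assms(4) by (auto simp: q''_def r_def)
  ultimately show ?case by blast
qed

section \<open>Quadratic forms attached to edges\<close>

text \<open>
  The coefficients of the quadratic form \<open>2 q u q v\<close> for \<open>e = {u, v}\<close>; summing over both
  orientations makes this a function of the unordered edge.
\<close>
definition edge_vec :: "('v \<Rightarrow> nat \<Rightarrow> real) \<Rightarrow> 'v set \<Rightarrow> nat \<times> nat \<Rightarrow> real" where
  "edge_vec q e ij = (\<Sum>u\<in>e. \<Sum>v\<in>e - {u}. q u (fst ij) * q v (snd ij))"

definition edge_interp :: "nat \<Rightarrow> 'v set set \<Rightarrow> ('v \<Rightarrow> nat \<Rightarrow> real) \<Rightarrow> bool" where
  "edge_interp k F q \<longleftrightarrow> lininterp ({..<k} \<times> {..<k}) F (edge_vec q)"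

lemma edge_vec_doubleton:
  "u \<noteq> v \<Longrightarrow> edge_vec q {u, v} (i, j) = q u i * q v j + q v i * q u j"
  by (simp add: edge_vec_def insert_Diff_if)

text \<open>The coefficients of the functional form an arbitrary array; adding the transpose gives a
  symmetric bilinear form with the same values, since \<open>edge_vec\<close> sums over both
  orientations.\<close>

lemma edge_interpD:
  assumes "edge_interp k F q" "\<And>e. e \<in> F \<Longrightarrow> card e = 2" "\<And>u v. g u v = g v u"
  shows "\<exists>A. (\<forall>i j. A i j = A j i) \<and>
    (\<forall>u v. {u, v} \<in> F \<longrightarrow> (\<Sum>i<k. \<Sum>j<k. A i j * q u i * q v j) = (g u v :: real))"
proof -
  \<comment> \<open>Symmetry of \<open>g\<close> lets it descend to unordered edges.\<close>
  define h where "h e = (SOME x. \<exists>u v. e = {u, v} \<and> x = g u v)" for e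
  have h: "h {u, v} = g u v" for u v
  proof -
    have "\<exists>u' v'. {u, v} = {u', v'} \<and> h {u, v} = g u' v'"
      unfolding h_def by (rule someI_ex) blast
    then show ?thesis using assms(3) by (auto simp: doubleton_eq_iff)
  qed
  have "\<exists>l. \<forall>e\<in>F. (\<Sum>i\<in>{..<k} \<times> {..<k}. l i * edge_vec q e i) = h e"
    using assms(1) unfolding edge_interp_def lininterp_def by blast
  then obtain l where l: "\<And>e. e \<in> F \<Longrightarrow> (\<Sum>i\<in>{..<k} \<times> {..<k}. l i * edge_vec q e i) = h e"
    by blast
  show ?thesis
  proof (intro exI[of _ "\<lambda>i j. l (i, j) + l (j, i)"] conjI allI impI)
    fix u v assume F: "{u, v} \<in> F"
    then have ne: "u \<noteq> v" using assms(2) by fastforce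
    have "g u v = (\<Sum>i<k. \<Sum>j<k. l (i, j) * (q u i * q v j + q v i * q u j))"
      using l[OF F] by (simp add: h sum.cartesian_product' edge_vec_doubleton[OF ne])
    also have "\<dots> = (\<Sum>i<k. \<Sum>j<k. l (i, j) * q u i * q v j) + (\<Sum>i<k. \<Sum>j<k. l (i, j) * q v i * q u j)"
      by (simp add: sum.distrib algebra_simps)
    also have "(\<Sum>i<k. \<Sum>j<k. l (i, j) * q v i * q u j) = (\<Sum>i<k. \<Sum>j<k. l (j, i) * q u i * q v j)"
      by (subst sum.swap) (simp add: mult_ac)
    finally show "(\<Sum>i<k. \<Sum>j<k. (l (i, j) + l (j, i)) * q u i * q v j) = g u v"
      by (simp add: sum.distrib algebra_simps)
  qed simp
qed

lemma edge_interpI: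
  assumes "\<And>e. e \<in> F \<Longrightarrow> card e = 2"
    and "\<And>g. (\<And>u v. g u v = (g v u :: real)) \<Longrightarrow>
      \<exists>A. (\<forall>i j. A i j = A j i) \<and> (\<forall>u v. {u, v} \<in> F \<longrightarrow> (\<Sum>i<k. \<Sum>j<k. A i j * q u i * q v j) = g u v)"
  shows "edge_interp k F q"
  unfolding edge_interp_def lininterp_def
proof
  fix g :: "'a set \<Rightarrow> real"
  have "\<exists>A. (\<forall>i j. A i j = A j i) \<and> (\<forall>u v. {u, v} \<in> F \<longrightarrow> (\<Sum>i<k. \<Sum>j<k. A i j * q u i * q v j) = g {u, v})"
    by (rule assms(2)) (simp add: insert_commute)
  then obtain A where A: "\<And>i j. A i j = A j i"
    "\<And>u v. {u, v} \<in> F \<Longrightarrow> (\<Sum>i<k. \<Sum>j<k. A i j * q u i * q v j) = g {u, v}" by blast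
  \<comment> \<open>The factor 1/2 compensates for the two orientations counted by
    \<open>edge_vec\<close>.\<close>
  have "(\<Sum>ij\<in>{..<k} \<times> {..<k}. (case ij of (i, j) \<Rightarrow> A i j / 2) * edge_vec q e ij) = g e" if eF: "e \<in> F" for e
  proof -
    obtain u v where e: "e = {u, v}" "u \<noteq> v" using assms(1)[OF eF] by (auto simp: card_2_iff)
    have "(\<Sum>ij\<in>{..<k} \<times> {..<k}. (case ij of (i, j) \<Rightarrow> A i j / 2) * edge_vec q e ij)
       = (\<Sum>i<k. \<Sum>j<k. A i j / 2 * (q u i * q v j + q v i * q u j))"
      unfolding sum.cartesian_product' by (simp add: e edge_vec_doubleton)
    also have "\<dots> = (\<Sum>i<k. \<Sum>j<k. A i j * q u i * q v j / 2 + A i j * q v i * q u j / 2)"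
      by (intro sum.cong refl) (simp add: algebra_simps)
    also have "\<dots> = (\<Sum>i<k. \<Sum>j<k. A i j * q u i * q v j) / 2 + (\<Sum>i<k. \<Sum>j<k. A i j * q v i * q u j) / 2"
      by (simp only: sum.distrib sum_divide_distrib)
    finally show ?thesis using A(2)[of u v] A(2)[of v u] eF e by (simp add: insert_commute)
  qed
  then show "\<exists>l. \<forall>e\<in>F. (\<Sum>i\<in>{..<k} \<times> {..<k}. l i * edge_vec q e i) = g e"
    by (intro exI) auto
qed

lemma eventually_edge_interp:
  assumes "finite F" "edge_interp k F q"
    and "\<And>v i. v \<in> \<Union>F \<Longrightarrow> i < k \<Longrightarrow> ((\<lambda>n. q' n v i) \<longlongrightarrow> q v i) Fl"
  shows "eventually (\<lambda>n. edge_interp k F (q' n)) Fl"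
  unfolding edge_interp_def
proof (rule eventually_lininterp)
  show "lininterp ({..<k} \<times> {..<k}) F (edge_vec q)" using assms(2) by (simp add: edge_interp_def)
  show "((\<lambda>n. edge_vec (q' n) w i) \<longlongrightarrow> edge_vec q w i) Fl"
    if "w \<in> F" "i \<in> {..<k} \<times> {..<k}" for w i
    unfolding edge_vec_def using that by (intro tendsto_intros assms(3)) auto
qed (use assms in auto)

text \<open>Scaling multiplies the product on \<open>{u, v}\<close> by the nonzero number
  \<open>s u * s v\<close>, by which the target values are divided in advance.\<close>

lemma edge_interp_scale:
  assumes "edge_interp k F q" "\<And>e. e \<in> F \<Longrightarrow> card e = 2" "\<And>v. v \<in> \<Union>F \<Longrightarrow> s v \<noteq> 0"
  shows "edge_interp k F (\<lambda>v i. s v * q v i)"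
proof (rule edge_interpI[OF assms(2)])
  fix g :: "'a \<Rightarrow> 'a \<Rightarrow> real" assume g: "\<And>u v. g u v = g v u"
  have "g u v / (s u * s v) = g v u / (s v * s u)" for u v
    using g[of u v] by (simp add: mult.commute)
  then have "\<exists>A. (\<forall>i j. A i j = A j i) \<and>
      (\<forall>u v. {u, v} \<in> F \<longrightarrow> (\<Sum>i<k. \<Sum>j<k. A i j * q u i * q v j) = g u v / (s u * s v))"
    by (intro edge_interpD[OF assms(1,2)])
  then obtain A where A: "\<And>i j. A i j = A j i"
    "\<And>u v. {u, v} \<in> F \<Longrightarrow> (\<Sum>i<k. \<Sum>j<k. A i j * q u i * q v j) = g u v / (s u * s v)"
    by blast
  have "(\<Sum>i<k. \<Sum>j<k. A i j * (s u * q u i) * (s v * q v j)) = g u v" if "{u, v} \<in> F" for u v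
  proof -
    have "(\<Sum>i<k. \<Sum>j<k. A i j * (s u * q u i) * (s v * q v j)) = (s u * s v) * (\<Sum>i<k. \<Sum>j<k. A i j * q u i * q v j)"
      by (simp add: sum_distrib_left mult_ac)
    moreover have "s u \<noteq> 0" "s v \<noteq> 0" using that by (auto intro!: assms(3))
    ultimately show ?thesis using A(2)[OF that] by simp
  qed
  with A(1) show "\<exists>A. (\<forall>i j. A i j = A j i) \<and> (\<forall>u v. {u, v} \<in> F \<longrightarrow> (\<Sum>i<k. \<Sum>j<k. A i j * (s u * q u i) * (s v * q v j)) = g u v)"
    by blast
qed auto

section \<open>Well-separated vertex sets\<close>

definition edges_at :: "'v set set \<Rightarrow> 'v \<Rightarrow> 'v set set" where
  "edges_at F v = {e \<in> F. v \<in> e}"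

definition edges_meeting :: "'v set set \<Rightarrow> 'v set \<Rightarrow> 'v set set" where
  "edges_meeting F A = {e \<in> F. e \<inter> A \<noteq> {}}"

text \<open>
  If all of \<open>A\<close> is sent to one vector \<open>x\<close>, the edges meeting \<open>A\<close> become \<open>x q w\<close> with distinct
  \<open>w\<close> outside \<open>A\<close>, plus possibly a single \<open>x x\<close>.
\<close>
definition spread :: "'v set set \<Rightarrow> 'v set \<Rightarrow> bool" where
  "spread F A \<longleftrightarrow>
     (\<forall>w. w \<notin> A \<longrightarrow> (\<forall>e\<in>edges_meeting F A. \<forall>e'\<in>edges_meeting F A. w \<in> e \<longrightarrow> w \<in> e' \<longrightarrow> e = e')) \<and>
     (\<forall>e\<in>F. \<forall>e'\<in>F. e \<subseteq> A \<longrightarrow> e' \<subseteq> A \<longrightarrow> e = e')"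

text \<open>The condition under which a greedy step is safe: the edges gained by adding
  \<open>v\<close> share no vertex with those already met. At least one edge is demanded so that the
  step makes progress.\<close>

definition far :: "'v set set \<Rightarrow> 'v set \<Rightarrow> 'v \<Rightarrow> bool" where
  "far F A v \<longleftrightarrow> edges_at F v \<noteq> {} \<and> (\<forall>e\<in>edges_at F v. e \<inter> \<Union>(edges_meeting F A) = {})"

definition triangle_free :: "'v set set \<Rightarrow> bool" where
  "triangle_free F \<longleftrightarrow>
     \<not> (\<exists>a b c. a \<noteq> b \<and> b \<noteq> c \<and> a \<noteq> c \<and> {a, b} \<in> F \<and> {b, c} \<in> F \<and> {a, c} \<in> F)"

text \<open>New edges are vertex-disjoint from old ones, so a conflict could only involve two edges
  at \<open>v\<close>, and these have no second common vertex.\<close>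

lemma spread_insert_far:
  assumes "spread F A" "far F A v" and two: "\<And>e. e \<in> F \<Longrightarrow> card e = 2"
  shows "spread F (insert v A)"
proof -
  have hit: "edges_meeting F (insert v A) = edges_meeting F A \<union> edges_at F v"
    by (auto simp: edges_meeting_def edges_at_def)
  have disj: "e \<inter> e' = {}" if "e \<in> edges_at F v" "e' \<in> edges_meeting F A" for e e'
    using assms(2) that by (fastforce simp: far_def)
  have pair: "e = {v, w}" if "e \<in> edges_at F v" "w \<in> e" "w \<noteq> v" for e w
  proof -
    have "card e = 2" "v \<in> e" using that two by (auto simp: edges_at_def)
    then show ?thesis using that by (auto simp: card_2_iff)
  qed
  have "e = e'" if "w \<notin> insert v A" "e \<in> edges_meeting F (insert v A)" "e' \<in> edges_meeting F (insert v A)"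
    "w \<in> e" "w \<in> e'" for w e e'
  proof -
    have "w \<notin> A" "w \<noteq> v" using that by auto
    then show ?thesis
      using that assms(1) disj pair unfolding hit spread_def by (metis IntI UnE emptyE)
  qed
  moreover have "e \<subseteq> A" if eF: "e \<in> F" and eA: "e \<subseteq> insert v A" for e
  proof (rule ccontr)
    assume "\<not> e \<subseteq> A"
    then have v: "v \<in> e" using eA by blast
    moreover obtain w where "w \<in> e" "w \<noteq> v"
      using two[OF eF] by (auto simp: card_2_iff)
    ultimately have "e \<in> edges_at F v" "e \<in> edges_meeting F A"
      using eF eA by (auto simp: edges_at_def edges_meeting_def)
    then show False using disj v by blast
  qed
  ultimately show ?thesis using assms(1) unfolding spread_def by metis
qed

lemma card_edges_meeting_insert_far:
  assumes "finite F" "far F A v"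
  shows "card (edges_meeting F (insert v A)) = card (edges_meeting F A) + card (edges_at F v)"
proof -
  have "edges_meeting F (insert v A) = edges_meeting F A \<union> edges_at F v"
    by (auto simp: edges_meeting_def edges_at_def)
  moreover have "edges_meeting F A \<inter> edges_at F v = {}"
    using assms(2) by (fastforce simp: far_def edges_at_def edges_meeting_def)
  moreover have "finite (edges_meeting F A)" "finite (edges_at F v)"
    using assms(1) by (auto simp: edges_meeting_def edges_at_def)
  ultimately show ?thesis by (simp add: card_Un_disjoint)
qed

lemma far_mono: "far F (insert v A) w \<Longrightarrow> far F A w"
  by (fastforce simp: far_def edges_meeting_def)

section \<open>Greedy growth of spread sets in graphs of maximum degree two\<close>

locale max_degree_two =
  fixes F :: "'v set set"
  assumes finite_F: "finite F"
    and card_edge: "e \<in> F \<Longrightarrow> card e = 2"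
    and degree_le: "card (edges_at F v) \<le> 2"
begin

lemma three_edges:
  assumes "e1 \<in> F" "e2 \<in> F" "e3 \<in> F" "v \<in> e1" "v \<in> e2" "v \<in> e3"
  shows "e1 = e2 \<or> e1 = e3 \<or> e2 = e3"
proof (rule ccontr)
  assume "\<not> ?thesis"
  then have "card {e1, e2, e3} = 3" by auto
  moreover have "card {e1, e2, e3} \<le> card (edges_at F v)"
    using assms finite_F by (intro card_mono) (auto simp: edges_at_def)
  ultimately show False using degree_le[of v] by simp
qed

lemma edge_eq: "e \<in> F \<Longrightarrow> u \<in> e \<Longrightarrow> v \<in> e \<Longrightarrow> u \<noteq> v \<Longrightarrow> e = {u, v}"
  using card_edge[of e] by (auto simp: card_2_iff)

text \<open>
  At most \<open>card M\<close> edges outside \<open>M = edges_meeting F A\<close> touch \<open>\<Union>M\<close>. If no vertex is far, both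
  ends of every remaining edge lie on such edges, which are all different.
\<close>
lemma exists_far:
  assumes large: "5 * card (edges_meeting F A) < 2 * card F"
  shows "\<exists>v. far F A v"
proof (rule ccontr)
  assume "\<nexists>v. far F A v"
  define M where "M = edges_meeting F A"
  define X where "X = \<Union>M"
  define H where "H = {e \<in> F. e \<notin> M \<and> e \<inter> X \<noteq> {}}"
  define D where "D = {e \<in> F. e \<inter> X = {}}"
  have fin: "finite M" "finite H" "finite D"
    using finite_F by (auto simp: M_def H_def D_def edges_meeting_def)
  have MF: "M \<subseteq> F" by (auto simp: M_def edges_meeting_def)
  have HA: "e \<inter> A = {}" if "e \<in> H" for e
    using that by (auto simp: H_def M_def edges_meeting_def)
  have MD: "M \<inter> D = {}"
    by (auto simp: M_def D_def X_def edges_meeting_def) 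
  have "F = M \<union> (H \<union> D)" using MF by (auto simp: H_def D_def)
  moreover have "M \<inter> (H \<union> D) = {}" "H \<inter> D = {}" using MD by (auto simp: H_def D_def)
  ultimately have cardF: "card F = card M + (card H + card D)"
    using fin by (metis card_Un_disjoint finite_UnI)
  have "\<exists>e'. e' \<in> M \<and> (\<exists>x. x \<in> e \<and> x \<in> e')" if "e \<in> H" for e
    using that by (auto simp: H_def X_def)
  then obtain h where h: "\<And>e. e \<in> H \<Longrightarrow> h e \<in> M \<and> (\<exists>x. x \<in> e \<and> x \<in> h e)" by metis
  \<comment> \<open>The vertex shared by \<open>e\<close> and \<open>h e\<close> lies outside
    \<open>A\<close>, hence is the outer end of \<open>h e\<close>. The degree bound leaves room for
    only one further edge there.\<close>
  have "inj_on h H"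
  proof (rule inj_onI)
    fix e1 e2 assume e: "e1 \<in> H" "e2 \<in> H" "h e1 = h e2"
    obtain x1 x2 where x: "x1 \<in> e1" "x1 \<in> h e1" "x2 \<in> e2" "x2 \<in> h e1"
      using h e by metis
    have "x1 \<notin> A" "x2 \<notin> A" using x HA e by auto
    obtain a where a: "a \<in> h e1" "a \<in> A"
      using h[OF e(1)] by (auto simp: M_def edges_meeting_def)
    have hF: "h e1 \<in> F" using h e MF by auto
    then have "h e1 = {a, x1}"
      using edge_eq[of "h e1" a x1] x(2) a \<open>x1 \<notin> A\<close> by auto
    then have "x1 = x2" using x(4) a \<open>x2 \<notin> A\<close> by auto
    moreover have "e1 \<noteq> h e1" "e2 \<noteq> h e1" using e(1,2) h[OF e(1)] by (auto simp: H_def)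
    ultimately show "e1 = e2"
      using three_edges[of e1 e2 "h e1" x1] e x hF by (auto simp: H_def)
  qed
  then have HM: "card H \<le> card M"
    using h fin by (intro card_inj_on_le[of h]) auto
  have "\<exists>f. f \<in> H \<and> u \<in> f" if "e \<in> D" "u \<in> e" for e u
  proof -
    have "edges_at F u \<noteq> {}" using that by (auto simp: D_def edges_at_def)
    moreover have "\<not> far F A u" using \<open>\<nexists>v. far F A v\<close> by blast
    ultimately obtain f where f: "f \<in> edges_at F u" "f \<inter> X \<noteq> {}"
      unfolding far_def X_def M_def by blast
    then show ?thesis using that by (auto simp: edges_at_def H_def D_def X_def)
  qed
  then obtain f0 where "\<And>e u. e \<in> D \<Longrightarrow> u \<in> e \<Longrightarrow> f0 e u \<in> H \<and> u \<in> f0 e u"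
    by metis
  then obtain f where f: "\<And>e u. e \<in> D \<Longrightarrow> u \<in> e \<Longrightarrow> f (e, u) \<in> H \<and> u \<in> f (e, u)"
    by (metis case_prod_conv)
  \<comment> \<open>An edge of \<open>H\<close> has an end in \<open>X\<close>, so it has at most
    one end on an edge of \<open>D\<close>; that end carries at most one other edge.\<close>
  have "inj_on f (Sigma D id)"
  proof (rule inj_onI, clarsimp)
    fix e1 u1 e2 u2 assume *: "e1 \<in> D" "u1 \<in> e1" "e2 \<in> D" "u2 \<in> e2" "f (e1, u1) = f (e2, u2)"
    define g where "g = f (e1, u1)"
    have g: "g \<in> F" "g \<inter> X \<noteq> {}" "u1 \<in> g" "u2 \<in> g"
      using f *(5) *(1-4) by (auto simp: g_def H_def)
    have "u1 \<notin> X" "u2 \<notin> X" using * by (auto simp: D_def)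
    then have "u1 = u2" using g edge_eq by blast
    moreover have "e1 \<noteq> g" "e2 \<noteq> g" using * g by (auto simp: D_def)
    ultimately show "e1 = e2 \<and> u1 = u2"
      using three_edges[of e1 e2 g u1] * g by (auto simp: D_def)
  qed
  moreover have "f ` Sigma D id \<subseteq> H" using f by auto
  ultimately have "card (Sigma D id) \<le> card H" using fin by (intro card_inj_on_le)
  moreover have "card (Sigma D id) = 2 * card D"
  proof -
    have "card (Sigma D id) = (\<Sum>e\<in>D. card e)"
      using fin finite_F card_edge by (subst card_SigmaI) (auto simp: D_def intro!: card_ge_0_finite)
    also have "\<dots> = (\<Sum>e\<in>D. 2)" by (intro sum.cong) (auto simp: D_def card_edge)
    finally show ?thesis by simp
  qed
  \<comment> \<open>Altogether \<open>2 * card D \<le> card H \<le> card M\<close>, so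
    \<open>2 * card F \<le> 5 * card M\<close>.\<close>
  ultimately show False using large cardF HM by (simp add: M_def)
qed

lemma card_edges_at_far: "far F A v \<Longrightarrow> card (edges_at F v) = 1 \<or> card (edges_at F v) = 2"
proof -
  assume "far F A v"
  then have "card (edges_at F v) > 0"
    using finite_F by (auto simp: far_def card_gt_0_iff edges_at_def)
  then show ?thesis using degree_le[of v] by linarith
qed

text \<open>A far vertex of degree two suffices. If \<open>v\<close> has degree one, a second far
  vertex \<open>w\<close> is sought: with degree one it joins \<open>v\<close>, with degree two it
  replaces \<open>v\<close>.\<close>

lemma extend_by_two:
  assumes "spread F A" "5 * (card (edges_meeting F A) + 1) < 2 * card F"
  shows "\<exists>A'. spread F A' \<and> card (edges_meeting F A') = card (edges_meeting F A) + 2"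
proof -
  obtain v where v: "far F A v" using exists_far[of A] assms by auto
  note sv = spread_insert_far[OF assms(1) v card_edge] card_edges_meeting_insert_far[OF finite_F v]
  show ?thesis
  proof (cases "card (edges_at F v) = 2")
    case True
    then show ?thesis using sv by auto
  next
    case False
    then have 1: "card (edges_at F v) = 1" using card_edges_at_far[OF v] by simp
    then obtain w where w: "far F (insert v A) w"
      using exists_far[of "insert v A"] assms(2) sv by auto
    note sw = spread_insert_far[OF sv(1) w card_edge] card_edges_meeting_insert_far[OF finite_F w]
    show ?thesis
    proof (cases "card (edges_at F w) = 2")
      case True
      then show ?thesis
        using spread_insert_far[OF assms(1) far_mono[OF w] card_edge]
          card_edges_meeting_insert_far[OF finite_F far_mono[OF w]] by auto
    next
      case False
      then have "card (edges_at F w) = 1" using card_edges_at_far[OF w] by simp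
      then show ?thesis using sw sv 1 by auto
    qed
  qed
qed

text \<open>The last extension starts at \<open>k - 2\<close> edges, where the requirement of
  \<open>extend_by_two\<close> is \<open>5 * (k - 1) < 2 * card F\<close>.\<close>

lemma extend_by_even:
  assumes "spread F A" "card (edges_meeting F A) + 2 * j = k" "5 * k < 2 * card F + 5"
  shows "\<exists>A'. spread F A' \<and> card (edges_meeting F A') = k"
  using assms
proof (induction j arbitrary: A)
  case (Suc j)
  then obtain A' where A': "spread F A'" "card (edges_meeting F A') = card (edges_meeting F A) + 2"
    using extend_by_two[of A] by auto
  show ?case by (rule Suc.IH[OF A'(1)]) (use A'(2) Suc.prems in auto)
qed auto

lemma spread_empty: "spread F {}"
  using card_edge by (fastforce simp: spread_def edges_meeting_def)

text \<open>Each far vertex adds one or two edges, so greedy growth overshoots the target by at most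
  one.\<close>

lemma exists_spread:
  assumes "5 * t < 2 * card F + 5"
  shows "\<exists>A. spread F A \<and> card (edges_meeting F A) \<in> {t, t + 1}"
  using assms
proof (induction t)
  case 0
  then show ?case using spread_empty by (intro exI[of _ "{}"]) (auto simp: edges_meeting_def)
next
  case (Suc t)
  then obtain A where A: "spread F A" "card (edges_meeting F A) \<in> {t, t + 1}" by auto
  show ?case
  proof (cases "card (edges_meeting F A) = t + 1")
    case False
    then have t: "card (edges_meeting F A) = t" using A by simp
    then obtain v where v: "far F A v" using exists_far[of A] Suc.prems by auto
    then show ?thesis
      using spread_insert_far[OF A(1) v card_edge] card_edges_meeting_insert_far[OF finite_F v]
        card_edges_at_far[OF v] t by (intro exI[of _ "insert v A"]) auto
  qed (use A in auto)
qed

text \<open>This supplies a start of odd parity. A vertex of degree one meets one edge. If there is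
  none, the two ends of an edge together meet three edges, and without triangles their outer ends
  are distinct.\<close>

lemma exists_spread_odd:
  assumes "triangle_free F" "F \<noteq> {}"
  shows "\<exists>A. spread F A \<and> card (edges_meeting F A) \<in> {1, 3}"
proof (cases "\<exists>v. card (edges_at F v) = 1")
  case True
  then obtain v where v: "card (edges_at F v) = 1" by blast
  have "edges_meeting F {} = {}" by (auto simp: edges_meeting_def)
  moreover from this v have "far F {} v" by (auto simp: far_def)
  ultimately show ?thesis
    using spread_insert_far[OF spread_empty _ card_edge, of v] v
      card_edges_meeting_insert_far[OF finite_F, of "{}" v]
    by (intro exI[of _ "{v}"]) auto
next
  case False
  have deg: "card (edges_at F v) = 2" if "e \<in> F" "v \<in> e" for e v
  proof -
    have "card (edges_at F v) > 0"
      using that finite_F by (auto simp: card_gt_0_iff edges_at_def)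
    then show ?thesis using degree_le[of v] False by (metis One_nat_def less_2_cases_iff linorder_not_less nat_less_le)
  qed
  obtain e where e: "e \<in> F" using assms(2) by blast
  then obtain a b where ab: "e = {a, b}" "a \<noteq> b" using card_edge[OF e] by (auto simp: card_2_iff)
  \<comment> \<open>Every end of \<open>e\<close> has exactly one other edge.\<close>
  have other: "\<exists>x'. x' \<noteq> y \<and> x' \<noteq> x \<and> edges_at F x = {e, {x, x'}}"
    if "e = {x, y}" "x \<noteq> y" for x y
  proof -
    have "card (edges_at F x) = 2" "e \<in> edges_at F x" using that e deg by (auto simp: edges_at_def)
    then obtain e1 e2 where "edges_at F x = {e1, e2}" "e1 \<noteq> e2" "e = e1 \<or> e = e2"
      by (auto simp: card_2_iff)
    then obtain e' where e': "edges_at F x = {e, e'}" "e' \<noteq> e" by blast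
    then have "e' \<in> F" "x \<in> e'" by (auto simp: edges_at_def)
    then obtain x' where "e' = {x, x'}" "x' \<noteq> x" using card_edge[of e'] by (auto simp: card_2_iff)
    then show ?thesis using e' that by auto
  qed
  obtain a' where a': "a' \<noteq> b" "a' \<noteq> a" "edges_at F a = {e, {a, a'}}" using other ab by blast
  obtain b' where b': "b' \<noteq> a" "b' \<noteq> b" "edges_at F b = {e, {b, b'}}"
    using other[of b a] ab by (auto simp: insert_commute)
  have inF: "{a, a'} \<in> F" "{b, b'} \<in> F" using a' b' by (auto simp: edges_at_def)
  have ne: "a' \<noteq> b'" using assms(1) inF e ab a' b' by (auto simp: triangle_free_def)
  have M: "edges_meeting F {a, b} = {{a, b}, {a, a'}, {b, b'}}"
  proof -
    have "edges_meeting F {a, b} = edges_at F a \<union> edges_at F b"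
      by (auto simp: edges_at_def edges_meeting_def)
    then show ?thesis using a' b' ab by auto
  qed
  have "card (edges_meeting F {a, b}) = 3"
    unfolding M using a' b' ab by (auto simp: doubleton_eq_iff card_insert_if)
  moreover have "spread F {a, b}"
    unfolding spread_def M
  proof (intro conjI allI impI ballI)
    fix f f' assume "f \<in> F" "f' \<in> F" "f \<subseteq> {a, b}" "f' \<subseteq> {a, b}"
    then have "f = {a, b}" "f' = {a, b}"
      using ab card_edge by (metis card_2_iff card_subset_eq finite.emptyI finite.insertI)+
    then show "f = f'" by simp
  next
    fix w f f' assume "w \<notin> {a, b}" "f \<in> {{a, b}, {a, a'}, {b, b'}}" "f' \<in> {{a, b}, {a, a'}, {b, b'}}" "w \<in> f" "w \<in> f'"
    then show "f = f'" using ne by auto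
  qed
  ultimately show ?thesis by blast
qed

end

section \<open>The number of edges to remove in one dimension step\<close>

lemma Suc_choose_two: "Suc k choose 2 = (k choose 2) + k"
  by (simp add: numeral_2_eq_2)

text \<open>Provides the size bound for greedy growth. It reduces to
  \<open>3 * k < k * (k - 1) + 5\<close>, that is, to positivity of
  \<open>(k - 2)^2 + 1\<close>.\<close>

lemma choose_two_bound:
  assumes "r \<le> k"
  shows "5 * r < 2 * ((k choose 2) + r) + 5"
proof (cases k)
  case (Suc j)
  have "3 * int k < (int k) * (int k - 1) + 5"
  proof -
    have "(int k - 2) ^ 2 \<ge> 0" by simp
    then show ?thesis by (simp add: power2_eq_square algebra_simps)
  qed
  moreover define c where "c = k choose 2"
  moreover have "2 * int (k choose 2) = int k * (int k - 1)"
  proof -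
    have "even (k * (k - 1))" by (cases k) auto
    then have "2 * (k choose 2) = k * (k - 1)" by (metis choose_two dvd_mult_div_cancel)
    then have "int (2 * (k choose 2)) = int (k * (k - 1))" by simp
    then show ?thesis using Suc by (simp add: algebra_simps)
  qed
  ultimately have "3 * int r < 2 * int c + 5" using assms by linarith
  then show ?thesis by (simp add: c_def)
qed (use assms in simp)

context max_degree_two
begin

lemma exists_spread_slack:
  assumes "card F \<le> Suc k choose 2"
  shows "\<exists>A. spread F A \<and> card (edges_meeting F A) \<le> Suc k \<and> card F \<le> (k choose 2) + card (edges_meeting F A)"
proof -
  \<comment> \<open>The excess over the forms available one dimension lower, truncated at 0.\<close>
  define r where "r = card F - (k choose 2)"
  have r: "r \<le> k" using assms by (simp add: Suc_choose_two r_def)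
  have "5 * r < 2 * card F + 5" using choose_two_bound[OF r] by (auto simp: r_def)
  then show ?thesis using exists_spread[of r] r by (auto simp: r_def)
qed

text \<open>Below the maximal edge count the target is less than \<open>k\<close>, so an overshoot
  by one is harmless. At the maximum exactly \<open>k\<close> edges are needed, reached in steps of
  two from a start of the right parity.\<close>

lemma exists_spread_tight:
  assumes "triangle_free F" "card F \<le> Suc k choose 2"
  shows "\<exists>A. spread F A \<and> card (edges_meeting F A) \<le> k \<and> card F \<le> (k choose 2) + card (edges_meeting F A)"
proof (cases "card F = Suc k choose 2 \<and> k > 0")
  case False
  define r where "r = card F - (k choose 2)"
  show ?thesis
  proof (cases "k = 0")
    case True
    then show ?thesis using spread_empty assms(2)
      by (intro exI[of _ "{}"]) (auto simp: Suc_choose_two edges_meeting_def)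
  next
    case k: False
    then have r: "r < k" using assms False by (simp add: Suc_choose_two r_def)
    then have "5 * r < 2 * card F + 5" using choose_two_bound[of r k] by (auto simp: r_def)
    then show ?thesis using exists_spread[of r] r by (auto simp: r_def)
  qed
next
  case True
  then have m: "card F = (k choose 2) + k" "k > 0" by (auto simp: Suc_choose_two)
  then have lt: "5 * k < 2 * card F + 5" using choose_two_bound[of k k] by simp
  have "\<exists>A j. spread F A \<and> card (edges_meeting F A) + 2 * j = k"
  proof (cases "even k")
    case True
    then obtain j where "k = 2 * j" by blast
    then show ?thesis using spread_empty by (intro exI[of _ "{}"]) (auto simp: edges_meeting_def)
  next
    case False
    obtain A where A: "spread F A" "card (edges_meeting F A) \<in> {1, 3}"
      using exists_spread_odd[OF assms(1)] m by fastforce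
    have "card (edges_meeting F A) \<le> card F"
      using finite_F by (intro card_mono) (auto simp: edges_meeting_def)
    \<comment> \<open>For \<open>k = 1\<close> there is a single edge, so the odd start cannot meet
      three.\<close>
    then have "k \<noteq> 1 \<or> card (edges_meeting F A) \<noteq> 3"
      using m by (auto simp: numeral_2_eq_2)
    moreover have "k \<noteq> 2" using False by auto
    ultimately have le: "card (edges_meeting F A) \<le> k" using A m by auto
    have "odd (card (edges_meeting F A))" using A by auto
    then have "even (k - card (edges_meeting F A))" using False le by simp
    then obtain j where "k - card (edges_meeting F A) = 2 * j" by blast
    then show ?thesis using A le by (intro exI[of _ A] exI[of _ j]) auto
  qed
  then obtain A where "spread F A" "card (edges_meeting F A) = k"
    using extend_by_even lt by blast
  then show ?thesis using m by auto
qed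

end

section \<open>Independent products of vectors\<close>

text \<open>Independence at \<open>N\<close> can be achieved by arbitrarily small perturbations,
  while \<open>edge_interp\<close> survives all sufficiently small ones.\<close>

lemma edge_interp_perturb:
  assumes "finite F" "edge_interp k F q" "finite N" "card N \<le> k"
  shows "\<exists>q'. edge_interp k F q' \<and> lininterp {..<k} N q'"
proof -
  have "\<exists>q'. (\<forall>w i. \<bar>q' w i - q w i\<bar> < inverse (real (Suc n))) \<and> lininterp {..<k} N q'" for n
    by (rule lininterp_perturb) (use assms in auto)
  then obtain Q where Q: "\<And>n w i. \<bar>Q n w i - q w i\<bar> < inverse (real (Suc n))"
    "\<And>n. lininterp {..<k} N (Q n)" by metis
  have "(\<lambda>n. Q n w i) \<longlonglongrightarrow> q w i" for w i
  proof (rule Lim_null[THEN iffD2], rule Lim_null_comparison)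
    show "eventually (\<lambda>n. norm (Q n w i - q w i) \<le> inverse (real (Suc n))) sequentially"
      using Q(1) by (simp add: less_imp_le)
  qed (rule LIMSEQ_inverse_real_of_nat)
  then have "eventually (\<lambda>n. edge_interp k F (Q n)) sequentially"
    by (intro eventually_edge_interp[OF assms(1,2)])
  then obtain n where "edge_interp k F (Q n)" using eventually_sequentially by auto
  then show ?thesis using Q(2) by blast
qed

text \<open>With \<open>A\<close> sent to the last unit vector, an edge meeting \<open>A\<close>
  yields the last variable times its outer end. At most \<open>k\<close> such outer ends are made
  independent in the old coordinates; the last variable squared serves one further edge
  \<open>e0\<close>.\<close>

lemma edge_interp_step:
  assumes fin: "finite F" and two: "\<And>e. e \<in> F \<Longrightarrow> card e = 2" and "spread F A"
    and card_le: "card (edges_meeting F A) \<le> Suc k"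
    and rest: "edge_interp k (F - edges_meeting F A) q0"
  shows "\<exists>q. edge_interp (Suc k) F q"
proof -
  define M where "M = edges_meeting F A"
  have MF: "M \<subseteq> F" and finM: "finite M" using fin by (auto simp: M_def edges_meeting_def)
  have sp1: "e = e'" if "w \<notin> A" "e \<in> M" "e' \<in> M" "w \<in> e" "w \<in> e'" for w e e'
    using \<open>spread F A\<close> that unfolding spread_def M_def by blast
  have sp2: "e = e'" if "e \<in> M" "e' \<in> M" "e \<subseteq> A" "e' \<subseteq> A" for e e'
  proof -
    have "\<forall>e\<in>F. \<forall>e'\<in>F. e \<subseteq> A \<longrightarrow> e' \<subseteq> A \<longrightarrow> e = e'"
      using \<open>spread F A\<close> unfolding spread_def by (rule conjunct2)
    moreover have "e \<in> F" "e' \<in> F" using that MF by auto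
    ultimately show ?thesis using that by simp
  qed
  \<comment> \<open>An edge inside \<open>A\<close> must be the exceptional one, as it gives exactly
    the square; otherwise any edge of \<open>M\<close> will do.\<close>
  obtain e0 where e0: "M \<noteq> {} \<Longrightarrow> e0 \<in> M" "\<And>e. e \<in> M \<Longrightarrow> e \<subseteq> A \<Longrightarrow> e = e0"
  proof (cases "\<exists>e\<in>M. e \<subseteq> A")
    case True
    then obtain e where "e \<in> M" "e \<subseteq> A" by blast
    then show ?thesis using that[of e] sp2 by blast
  next
    case False
    show ?thesis
    proof (cases "M = {}")
      case True
      then show ?thesis using that by simp
    next
      case ne: False
      then obtain e where "e \<in> M" by blast
      then show ?thesis using that[of e] False by blast
    qed
  qed
  have "\<exists>w. w \<in> e \<and> w \<notin> A" if "e \<in> M - {e0}" for e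
    using e0(2)[of e] that by blast
  then obtain out where out: "\<And>e. e \<in> M - {e0} \<Longrightarrow> out e \<in> e \<and> out e \<notin> A" by metis
  define N where "N = out ` (M - {e0})"
  have "card N \<le> card (M - {e0})" unfolding N_def using finM by (intro card_image_le) auto
  also have "\<dots> \<le> k"
  proof (cases "M = {}")
    case False
    then show ?thesis using e0(1) card_le finM by (simp add: M_def)
  qed simp
  finally have "card N \<le> k" .
  then obtain q1 where q1: "edge_interp k (F - M) q1" "lininterp {..<k} N q1"
    using edge_interp_perturb[of "F - M" k q0 N] rest fin finM by (auto simp: M_def N_def)
  \<comment> \<open>An end of \<open>e0\<close> outside \<open>A\<close> also gets last coordinate
    1, so that \<open>e0\<close> involves the square of the last variable.\<close>
  define q where "q v i = (if v \<in> A then (if i = k then 1 else 0) else if i < k then q1 v i else if v \<in> e0 then 1 else 0)"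
    for v i
  have "edge_interp (Suc k) F q"
  proof (rule edge_interpI[OF two])
    fix g :: "'a \<Rightarrow> 'a \<Rightarrow> real" assume g: "\<And>u v. g u v = g v u"
    \<comment> \<open>The neighbour of \<open>w\<close> in \<open>A\<close> along an edge other than
      \<open>e0\<close>; spreadness makes it unique.\<close>
    define nb where "nb w = (SOME a. a \<in> A \<and> {a, w} \<in> M - {e0})" for w
    have nb: "nb w = a" if "a \<in> A" "w \<notin> A" "{a, w} \<in> M - {e0}" for a w
    proof -
      have "nb w \<in> A \<and> {nb w, w} \<in> M - {e0}"
        unfolding nb_def by (rule someI[of _ a], intro conjI that)
      then show ?thesis using sp1[of w "{nb w, w}" "{a, w}"] that by (auto simp: doubleton_eq_iff)
    qed
    have "\<exists>l. \<forall>w\<in>N. (\<Sum>i<k. l i * q1 w i) = g (nb w) w"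
      using q1(2) unfolding lininterp_def by (rule spec)
    then obtain l where l: "\<And>w. w \<in> N \<Longrightarrow> (\<Sum>i<k. l i * q1 w i) = g (nb w) w" by blast
    define L where "L v = (\<Sum>i<k. l i * q v i)" for v
    obtain x0 y0 where xy: "M \<noteq> {} \<Longrightarrow> e0 = {x0, y0}"
    proof (cases "M = {}")
      case False
      then have "card e0 = 2" using e0(1) two MF by blast
      then show ?thesis using that by (auto simp: card_2_iff)
    qed (use that in blast)
    \<comment> \<open>The corner entry \<open>s\<close> is solved from the equation for
      \<open>e0\<close>. The sum has at most one term, for the outer end, and is empty if
      \<open>e0\<close> lies in \<open>A\<close>.\<close>
    define s where "s = g x0 y0 - (\<Sum>w\<in>e0 - A. L w)"
    \<comment> \<open>The contribution of the last row and column; it is subtracted from the targets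
      on the remaining edges before \<open>A'\<close> is chosen.\<close>
    define ex where "ex u v = q u k * L v + q v k * L u + s * q u k * q v k" for u v
    have ex_sym: "ex u v = ex v u" for u v by (simp add: ex_def algebra_simps)
    have sym: "g u v - ex u v = g v u - ex v u" for u v
      using g[of u v] ex_sym[of u v] by linarith
    have two': "card e = 2" if "e \<in> F - M" for e using that two by blast
    have "\<exists>A'. (\<forall>i j. A' i j = A' j i) \<and>
        (\<forall>u v. {u, v} \<in> F - M \<longrightarrow> (\<Sum>i<k. \<Sum>j<k. A' i j * q1 u i * q1 v j) = g u v - ex u v)"
      by (intro edge_interpD[OF q1(1)] two' sym)
    then obtain A' where A': "\<And>i j. A' i j = A' j i"
      "\<And>u v. {u, v} \<in> F - M \<Longrightarrow> (\<Sum>i<k. \<Sum>j<k. A' i j * q1 u i * q1 v j) = g u v - ex u v"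
      by blast
    \<comment> \<open>Block matrix with \<open>A'\<close> in the old coordinates, border
      \<open>l\<close> and corner \<open>s\<close>.\<close>
    define B where "B i j = (if i < k then (if j < k then A' i j else l i) else (if j < k then l j else s))" for i j
    have bil: "(\<Sum>i<Suc k. \<Sum>j<Suc k. B i j * q u i * q v j) = (\<Sum>i<k. \<Sum>j<k. A' i j * q u i * q v j) + ex u v" for u v
    proof -
      have "(\<Sum>i<Suc k. \<Sum>j<Suc k. B i j * q u i * q v j)
        = (\<Sum>i<k. \<Sum>j<k. B i j * q u i * q v j) + (\<Sum>i<k. B i k * q u i * q v k)
          + (\<Sum>j<k. B k j * q u k * q v j) + B k k * q u k * q v k"
        by (simp add: sum.distrib)
      moreover have "(\<Sum>i<k. \<Sum>j<k. B i j * q u i * q v j) = (\<Sum>i<k. \<Sum>j<k. A' i j * q u i * q v j)"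
        by (simp add: B_def)
      moreover have "(\<Sum>i<k. B i k * q u i * q v k) = q v k * L u"
        unfolding L_def sum_distrib_left by (intro sum.cong) (auto simp: B_def)
      moreover have "(\<Sum>j<k. B k j * q u k * q v j) = q u k * L v"
        unfolding L_def sum_distrib_left by (intro sum.cong) (auto simp: B_def)
      moreover have "B k k = s" by (simp add: B_def)
      ultimately show ?thesis by (simp add: ex_def)
    qed
    have main: "(\<Sum>i<k. \<Sum>j<k. A' i j * q u i * q v j) = 0" "(\<Sum>i<k. \<Sum>j<k. A' i j * q v i * q u j) = 0"
      "ex u v = g u v" if M: "{u, v} \<in> M" and u: "u \<in> A" for u v
    proof -
      have q0: "q u i = 0" if "i < k" for i using that u by (simp add: q_def)
      then show "(\<Sum>i<k. \<Sum>j<k. A' i j * q u i * q v j) = 0" "(\<Sum>i<k. \<Sum>j<k. A' i j * q v i * q u j) = 0"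
        by simp_all
      have "L u = 0" using q0 by (simp add: L_def)
      then have ex: "ex u v = L v + s * q v k" using u by (simp add: ex_def q_def)
      have ne: "M \<noteq> {}" using M by blast
      show "ex u v = g u v"
      proof (cases "{u, v} = e0")
        case True
        then have "g x0 y0 = g u v" using xy[OF ne] g by (auto simp: doubleton_eq_iff)
        moreover have "L v = (\<Sum>w\<in>e0 - A. L w)"
        proof (cases "v \<in> A")
          case True
          then have "e0 - A = {}" using \<open>{u, v} = e0\<close> u by blast
          moreover have "L v = 0" using True by (simp add: L_def q_def)
          ultimately show ?thesis by (simp only: sum.empty)
        next
          case False
          then have "e0 - A = {v}" using \<open>{u, v} = e0\<close> u by auto
          then show ?thesis by simp
        qed
        moreover have "q v k = 1" using True by (auto simp: q_def)
        ultimately show ?thesis unfolding ex s_def by simp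
      next
        case False
        then have v: "v \<notin> A" using e0(2)[OF M] u by auto
        have "v \<notin> e0" using sp1[OF v M e0(1)[OF ne]] False by blast
        then have "q v k = 0" using v by (simp add: q_def)
        moreover have "L v = (\<Sum>i<k. l i * q1 v i)" using v by (simp add: L_def q_def)
        moreover have "v \<in> N"
        proof -
          have "out {u, v} = v" using out[of "{u, v}"] M False u by auto
          moreover have "{u, v} \<in> M - {e0}" using M False by blast
          ultimately show ?thesis unfolding N_def by (metis image_eqI)
        qed
        moreover have "nb v = u" using nb[of u v] u v M False by blast
        ultimately show ?thesis using l[of v] by (simp add: ex)
      qed
    qed
    have "(\<Sum>i<Suc k. \<Sum>j<Suc k. B i j * q u i * q v j) = g u v" if F: "{u, v} \<in> F" for u v
    proof (cases "{u, v} \<in> M")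
      case True
      then have "u \<in> A \<or> v \<in> A" by (auto simp: M_def edges_meeting_def)
      then show ?thesis
      proof
        assume "u \<in> A"
        then show ?thesis unfolding bil using main(1,3)[OF True] by simp
      next
        assume v: "v \<in> A"
        have M': "{v, u} \<in> M" using True by (simp add: insert_commute)
        show ?thesis unfolding bil using main(2,3)[OF M' v] ex_sym[of u v] g[of u v] by linarith
      qed
    next
      case False
      then have "u \<notin> A" "v \<notin> A" using F by (auto simp: M_def edges_meeting_def)
      then have "(\<Sum>i<k. \<Sum>j<k. A' i j * q u i * q v j) = (\<Sum>i<k. \<Sum>j<k. A' i j * q1 u i * q1 v j)"
        by (intro sum.cong) (auto simp: q_def)
      then show ?thesis unfolding bil using A'(2) F False by simp
    qed
    moreover have "B i j = B j i" for i j using A'(1) by (simp add: B_def)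
    ultimately show "\<exists>A. (\<forall>i j. A i j = A j i) \<and>
        (\<forall>u v. {u, v} \<in> F \<longrightarrow> (\<Sum>i<Suc k. \<Sum>j<Suc k. A i j * q u i * q v j) = g u v)"
      by blast
  qed
  then show ?thesis by blast
qed

lemma edge_interp_empty: "edge_interp k {} q"
  by (simp add: edge_interp_def lininterp_def)

lemma max_degree_two_subset:
  assumes "max_degree_two F" "F' \<subseteq> F"
  shows "max_degree_two F'"
proof
  interpret max_degree_two F by fact
  show "finite F'" using finite_F assms(2) by (rule rev_finite_subset)
  show "card e = 2" if "e \<in> F'" for e using that assms(2) card_edge by blast
  have "card (edges_at F' v) \<le> card (edges_at F v)" for v
    using assms(2) finite_F by (intro card_mono) (auto simp: edges_at_def)
  then show "card (edges_at F' v) \<le> 2" for v using degree_le[of v] by (meson le_trans)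
qed

text \<open>The edge bound is the full dimension of the space of forms, so each step must remove
  enough edges without exceeding the new dimension. Triangle-freeness passes to the remaining
  edges.\<close>

lemma exists_edge_interp_tight:
  assumes "max_degree_two F" "triangle_free F" "card F \<le> Suc k choose 2"
  shows "\<exists>q. edge_interp k F q"
  using assms
proof (induction k arbitrary: F)
  case 0
  interpret max_degree_two F by fact
  have "F = {}" using 0 finite_F by (simp add: numeral_2_eq_2)
  then show ?case by (simp add: edge_interp_empty)
next
  case (Suc k)
  interpret max_degree_two F by fact
  obtain A where A: "spread F A" "card (edges_meeting F A) \<le> Suc k"
    "card F \<le> (Suc k choose 2) + card (edges_meeting F A)"
    using exists_spread_tight[OF Suc.prems(2,3)] by blast
  have "card (F - edges_meeting F A) \<le> Suc k choose 2"
    using A(3) finite_F by (subst card_Diff_subset) (auto simp: edges_meeting_def)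
  moreover have "triangle_free (F - edges_meeting F A)"
    using Suc.prems(2) unfolding triangle_free_def by blast
  moreover have "max_degree_two (F - edges_meeting F A)"
    by (rule max_degree_two_subset[OF Suc.prems(1)]) (rule Diff_subset)
  ultimately obtain q where q: "edge_interp k (F - edges_meeting F A) q"
    using Suc.IH by metis
  show ?case by (rule edge_interp_step[OF finite_F card_edge A(1,2) q])
qed

text \<open>One dimension more than the count asks for: each step can absorb the one surplus edge
  that greedy growth may produce.\<close>

lemma exists_edge_interp_slack:
  assumes "max_degree_two F" "card F \<le> Suc k choose 2"
  shows "\<exists>q. edge_interp (Suc k) F q"
  using assms
proof (induction k arbitrary: F)
  case 0
  interpret max_degree_two F by fact
  have "F = {}" using 0 finite_F by (simp add: numeral_2_eq_2)
  then show ?case by (simp add: edge_interp_empty)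
next
  case (Suc k)
  interpret max_degree_two F by fact
  obtain A where A: "spread F A" "card (edges_meeting F A) \<le> Suc (Suc k)"
    "card F \<le> (Suc k choose 2) + card (edges_meeting F A)"
    using exists_spread_slack[OF Suc.prems(2)] by blast
  have "card (F - edges_meeting F A) \<le> Suc k choose 2"
    using A(3) finite_F by (subst card_Diff_subset) (auto simp: edges_meeting_def)
  moreover have "max_degree_two (F - edges_meeting F A)"
    by (rule max_degree_two_subset[OF Suc.prems(1)]) (rule Diff_subset)
  ultimately obtain q where q: "edge_interp (Suc k) (F - edges_meeting F A) q"
    using Suc.IH by metis
  show ?case by (rule edge_interp_step[OF finite_F card_edge A(1,2) q])
qed

section \<open>Density of algebraically independent points\<close>

text \<open>A finitely supported map is determined by its graph over the support, a finite subset of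
  a countable set.\<close>

lemma countable_poly_mapping_keys_subset:
  assumes "countable A"
  shows "countable {f :: 'a \<Rightarrow>\<^sub>0 ('b :: {zero, countable}). Poly_Mapping.keys f \<subseteq> A}"
proof -
  define gr where "gr f = (\<lambda>x. (x, Poly_Mapping.lookup f x)) ` Poly_Mapping.keys f" for f :: "'a \<Rightarrow>\<^sub>0 'b"
  have "countable {T. finite T \<and> T \<subseteq> A \<times> (UNIV :: 'b set)}"
    using assms by (intro countable_Collect_finite_subset) auto
  moreover have "gr ` {f. Poly_Mapping.keys f \<subseteq> A} \<subseteq> {T. finite T \<and> T \<subseteq> A \<times> UNIV}"
    by (auto simp: gr_def)
  ultimately have "countable (gr ` {f. Poly_Mapping.keys f \<subseteq> A})"
    by (rule countable_subset[rotated])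
  moreover have "inj gr"
  proof (rule injI, rule poly_mapping_eqI)
    fix f g x assume eq: "gr f = gr g"
    have "(x, Poly_Mapping.lookup f x) \<in> gr g \<or> Poly_Mapping.lookup f x = 0"
      unfolding eq[symmetric] by (auto simp: gr_def in_keys_iff)
    moreover have "(x, Poly_Mapping.lookup g x) \<in> gr f \<or> Poly_Mapping.lookup g x = 0"
      unfolding eq by (auto simp: gr_def in_keys_iff)
    ultimately show "Poly_Mapping.lookup f x = Poly_Mapping.lookup g x"
      by (auto simp: gr_def)
  qed
  ultimately show ?thesis using countable_image_inj_on inj_on_subset by (metis subset_UNIV)
qed

lemma countable_mpolys:
  assumes "countable I"
  shows "countable {P :: 'i rat_mpoly. mpoly_vars P \<subseteq> I}"
proof -
  have "{P :: 'i rat_mpoly. mpoly_vars P \<subseteq> I}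
    = {P. Poly_Mapping.keys P \<subseteq> {m. Poly_Mapping.keys m \<subseteq> I}}"
    by (auto simp: mpoly_vars_def)
  then show ?thesis
    using countable_poly_mapping_keys_subset[OF countable_poly_mapping_keys_subset[OF assms]] by simp
qed

text \<open>Fixing the other variables at \<open>x\<close> turns \<open>P\<close> into a univariate
  polynomial. One of its coefficients comes from a nonzero polynomial over \<open>I\<close>, so
  independence of \<open>x\<close> keeps that coefficient nonzero.\<close>

lemma finite_mpoly_roots:
  assumes indep: "alg_independent I x" and i: "i \<notin> I"
    and P: "mpoly_vars P \<subseteq> insert i I" "P \<noteq> 0"
  shows "finite {y. mpoly_eval (x(i := y)) P = 0}"
proof -
  define c where "c m = of_rat (Poly_Mapping.lookup P m) * (\<Prod>j\<in>Poly_Mapping.keys m - {i}. x j ^ Poly_Mapping.lookup m j)"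
    for m :: "'a \<Rightarrow>\<^sub>0 nat"
  define p where "p = (\<Sum>m\<in>Poly_Mapping.keys P. monom (c m) (Poly_Mapping.lookup m i))"
  have ev: "mpoly_eval (x(i := y)) P = poly p y" for y
  proof -
    have "of_rat (Poly_Mapping.lookup P m) * (\<Prod>j\<in>Poly_Mapping.keys m. (x(i := y)) j ^ Poly_Mapping.lookup m j)
      = poly (monom (c m) (Poly_Mapping.lookup m i)) y" for m
    proof -
      have "(\<Prod>j\<in>Poly_Mapping.keys m. (x(i := y)) j ^ Poly_Mapping.lookup m j)
        = (\<Prod>j\<in>Poly_Mapping.keys m \<inter> {i}. (x(i := y)) j ^ Poly_Mapping.lookup m j)
          * (\<Prod>j\<in>Poly_Mapping.keys m - {i}. (x(i := y)) j ^ Poly_Mapping.lookup m j)"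
        by (subst prod.union_disjoint[symmetric]) (auto intro: prod.cong)
      also have "(\<Prod>j\<in>Poly_Mapping.keys m - {i}. (x(i := y)) j ^ Poly_Mapping.lookup m j)
        = (\<Prod>j\<in>Poly_Mapping.keys m - {i}. x j ^ Poly_Mapping.lookup m j)"
        by (intro prod.cong) auto
      also have "(\<Prod>j\<in>Poly_Mapping.keys m \<inter> {i}. (x(i := y)) j ^ Poly_Mapping.lookup m j) = y ^ Poly_Mapping.lookup m i"
        by (cases "i \<in> Poly_Mapping.keys m") (auto simp: in_keys_iff)
      finally show ?thesis by (simp add: poly_monom c_def)
    qed
    then show ?thesis by (simp add: mpoly_eval_def p_def poly_sum)
  qed
  have "p \<noteq> 0"
  proof
    assume "p = 0"
    \<comment> \<open>\<open>R\<close> below is the coefficient of the power \<open>e\<close> of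
      variable \<open>i\<close> in \<open>P\<close>: \<open>K\<close> collects the monomials with
      that power and \<open>r\<close> strips the variable from them. It is nonzero because of
      \<open>m0\<close>.\<close>
    obtain m0 where m0: "m0 \<in> Poly_Mapping.keys P" using P(2) by fastforce
    define e where "e = Poly_Mapping.lookup m0 i"
    define K where "K = {m \<in> Poly_Mapping.keys P. Poly_Mapping.lookup m i = e}"
    define r where "r m = m - Poly_Mapping.single i (Poly_Mapping.lookup m i)" for m :: "'a \<Rightarrow>\<^sub>0 nat"
    have lr: "Poly_Mapping.lookup (r m) j = (if j = i then 0 else Poly_Mapping.lookup m j)" for m j
      by (auto simp: r_def lookup_minus lookup_single when_def)
    have kr: "Poly_Mapping.keys (r m) = Poly_Mapping.keys m - {i}" for m
      by (auto simp: in_keys_iff lr split: if_splits)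
    have finK: "finite K" by (simp add: K_def)
    have inj: "inj_on r K"
    proof (rule inj_onI, rule poly_mapping_eqI)
      fix m m' j assume "m \<in> K" "m' \<in> K" "r m = r m'"
      then show "Poly_Mapping.lookup m j = Poly_Mapping.lookup m' j"
        using lr[of m j] lr[of m' j] by (auto simp: K_def split: if_splits)
    qed
    define R where "R = (\<Sum>m\<in>K. Poly_Mapping.single (r m) (Poly_Mapping.lookup P m))"
    have lR: "Poly_Mapping.lookup R (r m) = Poly_Mapping.lookup P m" if "m \<in> K" for m
    proof -
      have "Poly_Mapping.lookup R (r m) = (\<Sum>m'\<in>K. if m' = m then Poly_Mapping.lookup P m' else 0)"
        unfolding R_def lookup_sum
        using that inj by (intro sum.cong) (auto simp: lookup_single when_def inj_on_def)
      then show ?thesis using finK that by simp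
    qed
    have keysR: "Poly_Mapping.keys R = r ` K"
    proof
      show "Poly_Mapping.keys R \<subseteq> r ` K"
      proof
        fix k assume "k \<in> Poly_Mapping.keys R"
        then have "(\<Sum>m\<in>K. Poly_Mapping.lookup (Poly_Mapping.single (r m) (Poly_Mapping.lookup P m)) k) \<noteq> 0"
          by (simp add: R_def lookup_sum in_keys_iff)
        then obtain m where "m \<in> K" "Poly_Mapping.lookup (Poly_Mapping.single (r m) (Poly_Mapping.lookup P m)) k \<noteq> 0"
          by (meson sum.neutral)
        then show "k \<in> r ` K" by (auto simp: lookup_single when_def split: if_splits)
      qed
      show "r ` K \<subseteq> Poly_Mapping.keys R"
        using lR by (auto simp: in_keys_iff K_def)
    qed
    have "mpoly_vars R \<subseteq> I"
      using P(1) by (auto simp: mpoly_vars_def keysR kr K_def)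
    moreover have "mpoly_eval x R = coeff p e"
    proof -
      have "mpoly_eval x R = (\<Sum>m\<in>K. of_rat (Poly_Mapping.lookup R (r m)) *
          (\<Prod>j\<in>Poly_Mapping.keys (r m). x j ^ Poly_Mapping.lookup (r m) j))"
        unfolding mpoly_eval_def keysR using inj by (simp add: sum.reindex)
      also have "\<dots> = (\<Sum>m\<in>K. c m)"
        by (intro sum.cong) (auto simp: lR c_def kr lr intro!: prod.cong)
      also have "\<dots> = coeff p e"
        unfolding p_def coeff_sum coeff_monom K_def by (simp add: sum.inter_filter)
      finally show ?thesis .
    qed
    ultimately have "R = 0"
      using indep \<open>p = 0\<close> by (simp add: alg_independent_def)
    moreover have "r m0 \<in> Poly_Mapping.keys R" using m0 by (auto simp: keysR K_def e_def)
    ultimately show False by simp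
  qed
  then show ?thesis unfolding ev by (rule poly_roots_finite)
qed

lemma alg_independent_empty: "alg_independent {} x"
proof -
  have "P = 0" if "mpoly_vars P \<subseteq> {}" "mpoly_eval x P = 0" for P :: "'a rat_mpoly"
  proof (rule ccontr)
    assume "P \<noteq> 0"
    moreover have "Poly_Mapping.keys P \<subseteq> {0}"
      using that(1) by (auto simp: mpoly_vars_def)
    ultimately have "Poly_Mapping.keys P = {0}"
      by (metis keys_eq_empty subset_singletonD)
    then show False
      using that(2) by (simp add: mpoly_eval_def flip: not_in_keys_iff_lookup_eq_zero)
  qed
  then show ?thesis by (simp add: alg_independent_def)
qed

text \<open>Coordinates are chosen one at a time: countably many polynomials exclude finitely many
  values each, and an interval is uncountable.\<close>

lemma alg_independent_dense:
  assumes "finite I" "e > 0"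
  shows "\<exists>x. alg_independent I x \<and> (\<forall>i\<in>I. \<bar>x i - x0 i\<bar> < e)"
  using assms(1)
proof induction
  case empty
  then show ?case using alg_independent_empty by blast
next
  case (insert i I)
  then obtain x where x: "alg_independent I x" "\<And>j. j \<in> I \<Longrightarrow> \<bar>x j - x0 j\<bar> < e" by blast
  define Ps where "Ps = {P :: 'a rat_mpoly. mpoly_vars P \<subseteq> insert i I} - {0}"
  have "countable Ps"
    unfolding Ps_def using insert.hyps by (intro countable_Diff countable_mpolys) (auto intro: countable_finite)
  then have "countable (\<Union>P\<in>Ps. {y. mpoly_eval (x(i := y)) P = 0})"
    using finite_mpoly_roots[OF x(1) insert.hyps(2)]
    by (intro countable_UN) (auto simp: Ps_def intro!: countable_finite)
  moreover have "uncountable {x0 i - e<..<x0 i + e}"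
    using assms(2) by (simp add: uncountable_open_interval)
  ultimately have "\<not> {x0 i - e<..<x0 i + e} \<subseteq> (\<Union>P\<in>Ps. {y. mpoly_eval (x(i := y)) P = 0})"
    using countable_subset by blast
  then obtain y where y: "y \<in> {x0 i - e<..<x0 i + e}" "\<And>P. P \<in> Ps \<Longrightarrow> mpoly_eval (x(i := y)) P \<noteq> 0"
    by blast
  have "alg_independent (insert i I) (x(i := y))"
    using y(2) by (auto simp: alg_independent_def Ps_def)
  moreover have "\<forall>j\<in>insert i I. \<bar>(x(i := y)) j - x0 j\<bar> < e"
    using x(2) y(1) insert.hyps by auto
  ultimately show ?case by blast
qed

section \<open>Infinitesimal rigidity by Gale duality\<close>

definition sqd :: "nat \<Rightarrow> 'v config \<Rightarrow> 'v \<Rightarrow> 'v \<Rightarrow> real" where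
  "sqd d m u v = (\<Sum>c<d. (m u c - m v c)\<^sup>2)"

text \<open>Half the derivative of \<open>sqd\<close> at \<open>m\<close> in direction
  \<open>\<delta>\<close>; it vanishes on all edges exactly for infinitesimal motions.\<close>

definition vdot :: "nat \<Rightarrow> 'v config \<Rightarrow> 'v config \<Rightarrow> 'v \<Rightarrow> 'v \<Rightarrow> real" where
  "vdot d m \<delta> u v = (\<Sum>c<d. (m u c - m v c) * (\<delta> u c - \<delta> v c))"

lemma vdot_commute: "vdot d m \<delta> u v = vdot d m \<delta> v u"
  unfolding vdot_def by (intro sum.cong) (auto simp: algebra_simps)

lemma vdot_self [simp]: "vdot d m \<delta> u u = 0"
  by (simp add: vdot_def)

text \<open>Expanding the product gives four terms, each containing one of the four vanishing sums
  as a factor.\<close>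

lemma sum_vdot_eq_0:
  assumes a: "(\<Sum>u\<in>V. a u) = 0" "\<And>c. c < d \<Longrightarrow> (\<Sum>u\<in>V. a u * m u c) = 0"
    and b: "(\<Sum>u\<in>V. b u) = 0" "\<And>c. c < d \<Longrightarrow> (\<Sum>u\<in>V. b u * m u c) = 0"
  shows "(\<Sum>u\<in>V. \<Sum>v\<in>V. vdot d m \<delta> u v * a u * b v) = 0"
proof -
  have "(\<Sum>u\<in>V. \<Sum>v\<in>V. vdot d m \<delta> u v * a u * b v)
    = (\<Sum>u\<in>V. \<Sum>v\<in>V. \<Sum>c<d. (m u c - m v c) * (\<delta> u c - \<delta> v c) * a u * b v)"
    by (simp add: vdot_def sum_distrib_right)
  also have "\<dots> = (\<Sum>u\<in>V. \<Sum>c<d. \<Sum>v\<in>V. (m u c - m v c) * (\<delta> u c - \<delta> v c) * a u * b v)"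
    by (intro sum.cong refl sum.swap)
  also have "\<dots> = (\<Sum>c<d. \<Sum>u\<in>V. \<Sum>v\<in>V. (m u c - m v c) * (\<delta> u c - \<delta> v c) * a u * b v)"
    by (rule sum.swap)
  also have "\<dots> = (\<Sum>c<d. 0)"
  proof (intro sum.cong refl)
    fix c assume "c \<in> {..<d}"
    then have c: "c < d" by simp
    have "(\<Sum>u\<in>V. \<Sum>v\<in>V. (m u c - m v c) * (\<delta> u c - \<delta> v c) * a u * b v)
      = (\<Sum>u\<in>V. \<Sum>v\<in>V. (a u * m u c * \<delta> u c) * b v - (a u * m u c) * (b v * \<delta> v c)
          - (a u * \<delta> u c) * (b v * m v c) + a u * (b v * m v c * \<delta> v c))"
      by (intro sum.cong) (auto simp: algebra_simps)
    also have "\<dots> = (\<Sum>u\<in>V. a u * m u c * \<delta> u c) * (\<Sum>v\<in>V. b v)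
        - (\<Sum>u\<in>V. a u * m u c) * (\<Sum>v\<in>V. b v * \<delta> v c)
        - (\<Sum>u\<in>V. a u * \<delta> u c) * (\<Sum>v\<in>V. b v * m v c)
        + (\<Sum>u\<in>V. a u) * (\<Sum>v\<in>V. b v * m v c * \<delta> v c)"
      by (simp only: sum.distrib sum_subtractf sum_product)
    finally show "(\<Sum>u\<in>V. \<Sum>v\<in>V. (m u c - m v c) * (\<delta> u c - \<delta> v c) * a u * b v) = 0"
      using a b c by simp
  qed
  finally show ?thesis by simp
qed

text \<open>
  The matrix \<open>C = (vdot d m \<delta> u v)\<close> is supported on \<open>F\<close> and satisfies \<open>Q C Q\<^sup>T = 0\<close>, which pairs
  to zero with every quadratic form.
\<close>
lemma vdot_zero_of_edge_interp:
  assumes fin: "finite V" and F: "\<And>e. e \<in> F \<Longrightarrow> card e = 2"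
    and Q: "edge_interp k F Q" "\<And>i. i < k \<Longrightarrow> (\<Sum>v\<in>V. Q v i) = 0"
      "\<And>i c. i < k \<Longrightarrow> c < d \<Longrightarrow> (\<Sum>v\<in>V. Q v i * m v c) = 0"
    and edges: "\<And>u v. u \<in> V \<Longrightarrow> v \<in> V \<Longrightarrow> u \<noteq> v \<Longrightarrow> {u, v} \<notin> F \<Longrightarrow> vdot d m \<delta> u v = 0"
    and xy: "x \<in> V" "y \<in> V"
  shows "vdot d m \<delta> x y = 0"
proof (cases "x \<noteq> y \<and> {x, y} \<in> F")
  case False
  then show ?thesis using edges xy by (cases "x = y") auto
next
  case True
  \<comment> \<open>Pairing with the indicator of the edge \<open>{x, y}\<close> isolates twice the
    entry to be shown zero.\<close>
  define g where "g u v = (if {u, v} = {x, y} then 1 else 0 :: real)" for u v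
  have "\<exists>A. (\<forall>i j. A i j = A j i) \<and>
      (\<forall>u v. {u, v} \<in> F \<longrightarrow> (\<Sum>i<k. \<Sum>j<k. A i j * Q u i * Q v j) = g u v)"
    by (rule edge_interpD[OF Q(1) F]) (auto simp: g_def insert_commute)
  then obtain A where A: "\<And>u v. {u, v} \<in> F \<Longrightarrow> (\<Sum>i<k. \<Sum>j<k. A i j * Q u i * Q v j) = g u v"
    by blast
  let ?C = "vdot d m \<delta>"
  have "(\<Sum>u\<in>V. \<Sum>v\<in>V. ?C u v * (\<Sum>i<k. \<Sum>j<k. A i j * Q u i * Q v j))
    = (\<Sum>u\<in>V. \<Sum>v\<in>V. (if u = x then if v = y then ?C x y else 0 else 0)
        + (if u = y then if v = x then ?C x y else 0 else 0))"
  proof (intro sum.cong refl)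
    fix u v assume uv: "u \<in> V" "v \<in> V"
    show "?C u v * (\<Sum>i<k. \<Sum>j<k. A i j * Q u i * Q v j)
      = (if u = x then if v = y then ?C x y else 0 else 0) + (if u = y then if v = x then ?C x y else 0 else 0)"
    proof (cases "{u, v} \<in> F")
      case True
      then show ?thesis
        using A[OF True] \<open>x \<noteq> y \<and> {x, y} \<in> F\<close> vdot_commute[of d m \<delta> x y]
        by (auto simp: g_def doubleton_eq_iff)
    next
      case False
      then have "?C u v = 0" using edges[OF uv] by (cases "u = v") auto
      moreover have "\<not> (u = x \<and> v = y)" "\<not> (u = y \<and> v = x)"
        using False \<open>x \<noteq> y \<and> {x, y} \<in> F\<close> by (auto simp: insert_commute)
      ultimately show ?thesis by auto
    qed
  qed
  also have "\<dots> = ?C x y + ?C x y"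
  proof -
    have "(\<Sum>u\<in>V. \<Sum>v\<in>V. if u = a then if v = b then ?C x y else 0 else 0) = ?C x y"
      if "a \<in> V" "b \<in> V" for a b
    proof -
      have "(\<Sum>u\<in>V. \<Sum>v\<in>V. if u = a then if v = b then ?C x y else 0 else 0)
        = (\<Sum>u\<in>V. if u = a then \<Sum>v\<in>V. if v = b then ?C x y else 0 else 0)"
        by (intro sum.cong) auto
      then show ?thesis using fin that by simp
    qed
    then show ?thesis using xy by (simp add: sum.distrib)
  qed
  finally have 1: "(\<Sum>u\<in>V. \<Sum>v\<in>V. ?C u v * (\<Sum>i<k. \<Sum>j<k. A i j * Q u i * Q v j)) = 2 * ?C x y"
    by simp
  have "(\<Sum>u\<in>V. \<Sum>v\<in>V. ?C u v * (\<Sum>i<k. \<Sum>j<k. A i j * Q u i * Q v j))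
    = (\<Sum>uv\<in>V \<times> V. \<Sum>ij\<in>{..<k} \<times> {..<k}. A (fst ij) (snd ij) * (?C (fst uv) (snd uv) * Q (fst uv) (fst ij) * Q (snd uv) (snd ij)))"
    unfolding sum.cartesian_product' by (simp add: sum_distrib_left mult_ac)
  also have "\<dots> = (\<Sum>ij\<in>{..<k} \<times> {..<k}. \<Sum>uv\<in>V \<times> V. A (fst ij) (snd ij) * (?C (fst uv) (snd uv) * Q (fst uv) (fst ij) * Q (snd uv) (snd ij)))"
    by (rule sum.swap)
  also have "\<dots> = (\<Sum>i<k. \<Sum>j<k. A i j * (\<Sum>u\<in>V. \<Sum>v\<in>V. ?C u v * Q u i * Q v j))"
    unfolding sum.cartesian_product' by (simp add: sum_distrib_left)
  also have "\<dots> = (\<Sum>i<k. \<Sum>j<k. A i j * 0)"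
    by (intro sum.cong refl arg_cong2[where f = "(*)"] sum_vdot_eq_0) (use Q in auto)
  finally show ?thesis using 1 by simp
qed

section \<open>Frames and inner products determined by squared distances\<close>

definition ip :: "nat \<Rightarrow> 'v config \<Rightarrow> 'v \<Rightarrow> 'v \<Rightarrow> 'v \<Rightarrow> real" where
  "ip d m w u v = (\<Sum>c<d. (m u c - m w c) * (m v c - m w c))"

text \<open>Polarization: inner products based at \<open>w\<close> converge as soon as squared
  distances do, whatever congruence is applied to the configurations.\<close>

lemma ip_sqd: "ip d m w u v = (sqd d m u w + sqd d m v w - sqd d m u v) / 2"
proof -
  have "2 * ip d m w u v = (\<Sum>c<d. (m u c - m w c)\<^sup>2 + (m v c - m w c)\<^sup>2 - (m u c - m v c)\<^sup>2)"
    unfolding ip_def sum_distrib_left by (intro sum.cong) (auto simp: power2_eq_square algebra_simps)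
  then show ?thesis by (simp add: sqd_def sum.distrib sum_subtractf)
qed

text \<open>A Gram matrix near the identity makes \<open>f\<close> a basis. The coordinates of
  \<open>x\<close> solve the Gram system with right-hand side the inner products of \<open>x\<close>
  with \<open>f\<close>, and diagonal dominance bounds them.\<close>

lemma frame_coordinates:
  fixes f :: "nat \<Rightarrow> nat \<Rightarrow> real"
  assumes G: "\<And>i j. i < d \<Longrightarrow> j < d \<Longrightarrow> \<bar>(\<Sum>c<d. f i c * f j c) - (if i = j then 1 else 0)\<bar> \<le> 1 / (2 * real d)"
  shows "\<exists>\<mu>. (\<forall>c<d. (\<Sum>j<d. \<mu> j * f j c) = x c) \<and>
    (\<forall>j<d. \<bar>\<mu> j\<bar> \<le> 2 * (\<Sum>i<d. \<bar>\<Sum>c<d. x c * f i c\<bar>))"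
proof -
  define T where "T i j = (\<Sum>c<d. f i c * f j c)" for i j
  have T: "\<bar>T i j - (if i = j then 1 else 0)\<bar> \<le> 1 / (2 * real (card {..<d}))"
    if "i \<in> {..<d}" "j \<in> {..<d}" for i j
    using that G by (simp add: T_def)
  have TC: "(\<Sum>j<d. T i j * C j) = (\<Sum>c<d. f i c * (\<Sum>j<d. C j * f j c))" for i C
  proof -
    have "(\<Sum>j<d. T i j * C j) = (\<Sum>j<d. \<Sum>c<d. f i c * (C j * f j c))"
      by (simp add: T_def sum_distrib_left sum_distrib_right mult_ac)
    also have "\<dots> = (\<Sum>c<d. \<Sum>j<d. f i c * (C j * f j c))" by (rule sum.swap)
    finally show ?thesis by (simp add: sum_distrib_left)
  qed
  have "lininterp {..<d} {..<d} f"
  proof (rule lininterpI_indep, goal_cases)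
    case (3 C)
    show ?case
    proof
      fix j assume j: "j \<in> {..<d}"
      have "\<bar>\<Sum>w'\<in>{..<d}. T i w' * C w'\<bar> \<le> 0" if "i \<in> {..<d}" for i
        unfolding TC using 3 by simp
      then have "\<bar>C j\<bar> \<le> 2 * 0"
        using j by (intro diag_dominant_bound[where W = "{..<d}" and T = T and B = 0] T) auto
      then show "C j = 0" by simp
    qed
  qed auto
  then have "lininterp {..<d} {..<d} (\<lambda>c j. f j c)"
    using lininterp_spanning[of "{..<d}" "{..<d}" f] by simp
  then have "\<exists>\<mu>. \<forall>c\<in>{..<d}. (\<Sum>j<d. \<mu> j * f j c) = x c"
    unfolding lininterp_def by (rule spec)
  then obtain \<mu> where \<mu>: "\<And>c. c < d \<Longrightarrow> (\<Sum>j<d. \<mu> j * f j c) = x c" by auto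
  have "\<bar>\<mu> j\<bar> \<le> 2 * (\<Sum>i<d. \<bar>\<Sum>c<d. x c * f i c\<bar>)" if "j < d" for j
  proof (rule diag_dominant_bound[where W = "{..<d}" and T = T])
    fix i assume i: "i \<in> {..<d}"
    have "(\<Sum>j<d. T i j * \<mu> j) = (\<Sum>c<d. x c * f i c)"
      unfolding TC by (intro sum.cong) (auto simp: \<mu>)
    also have "\<bar>\<dots>\<bar> \<le> (\<Sum>i<d. \<bar>\<Sum>c<d. x c * f i c\<bar>)"
      using i by (intro member_le_sum[where f = "\<lambda>i. \<bar>\<Sum>c<d. x c * f i c\<bar>"]) auto
    finally show "\<bar>\<Sum>j<d. T i j * \<mu> j\<bar> \<le> (\<Sum>i<d. \<bar>\<Sum>c<d. x c * f i c\<bar>)" .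
  qed (use T that in auto)
  then show ?thesis using \<mu> by blast
qed

text \<open>
  Here \<open>F\<close> is the set of non-edges of the framework.
\<close>
definition inf_rigid :: "nat \<Rightarrow> 'v set \<Rightarrow> 'v set set \<Rightarrow> 'v config \<Rightarrow> bool" where
  "inf_rigid d V F m \<longleftrightarrow>
     (\<forall>\<delta>. (\<forall>u\<in>V. \<forall>v\<in>V. u \<noteq> v \<longrightarrow> {u, v} \<notin> F \<longrightarrow> vdot d m \<delta> u v = 0) \<longrightarrow>
       (\<forall>u\<in>V. \<forall>v\<in>V. vdot d m \<delta> u v = 0))"

text \<open>Each of the \<open>k\<close> coordinate rows of \<open>q\<close> is an affine dependency
  of the points \<open>p v\<close>.\<close>

definition gale_pair :: "nat \<Rightarrow> nat \<Rightarrow> 'v set \<Rightarrow> 'v config \<Rightarrow> 'v config \<Rightarrow> bool" where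
  "gale_pair k d V q p \<longleftrightarrow>
     (\<forall>i<k. (\<Sum>v\<in>V. q v i) = 0) \<and> (\<forall>i<k. \<forall>c<d. (\<Sum>v\<in>V. q v i * p v c) = 0)"

text \<open>With this normalization, inner products based at \<open>b 0\<close> against
  \<open>b (Suc j)\<close> read off coordinate \<open>j\<close>.\<close>

definition simplex_frame :: "nat \<Rightarrow> 'v set \<Rightarrow> 'v config \<Rightarrow> (nat \<Rightarrow> 'v) \<Rightarrow> bool" where
  "simplex_frame d V p b \<longleftrightarrow>
     (\<forall>j\<le>d. b j \<in> V) \<and> (\<forall>c<d. p (b 0) c = 0) \<and>
     (\<forall>j<d. \<forall>c<d. p (b (Suc j)) c = (if c = j then 1 else 0))"

text \<open>
  Nearness is measured by squared distances, so that it is invariant under congruences and persists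
  along a motion. The Gale dual \<open>q0\<close> is corrected at the vertices of the frame only.
\<close>
lemma inf_rigid_near:
  fixes p0 :: "'v config"
  assumes fin: "finite V" and finF: "finite F"
    and F: "\<And>e. e \<in> F \<Longrightarrow> card e = 2"
    and interp: "edge_interp k F q0" and gale: "gale_pair k d V q0 p0" and frame: "simplex_frame d V p0 b"
  shows "\<exists>e>0. \<forall>m. (\<forall>u\<in>V. \<forall>v\<in>V. \<bar>sqd d m u v - sqd d p0 u v\<bar> < e) \<longrightarrow> inf_rigid d V F m"
    (is "\<exists>e>0. \<forall>m. ?near e m \<longrightarrow> ?good m")
proof (rule ccontr)
  assume neg: "\<not> ?thesis"
  have q0: "edge_interp k F q0" "\<And>i. i < k \<Longrightarrow> (\<Sum>v\<in>V. q0 v i) = 0"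
    "\<And>i c. i < k \<Longrightarrow> c < d \<Longrightarrow> (\<Sum>v\<in>V. q0 v i * p0 v c) = 0"
    using interp gale by (simp_all add: gale_pair_def)
  have b: "\<And>j. j \<le> d \<Longrightarrow> b j \<in> V"
    and p0: "\<And>c. c < d \<Longrightarrow> p0 (b 0) c = 0"
      "\<And>j c. j < d \<Longrightarrow> c < d \<Longrightarrow> p0 (b (Suc j)) c = (if c = j then 1 else 0)"
    using frame by (simp_all add: simplex_frame_def)
  have "\<exists>m. ?near (inverse (real (Suc n))) m \<and> \<not> ?good m" for n
  proof (rule ccontr)
    assume "\<not> ?thesis"
    then have "\<forall>m. ?near (inverse (real (Suc n))) m \<longrightarrow> ?good m" by blast
    moreover have "inverse (real (Suc n)) > 0" by simp
    ultimately show False using neg by blast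
  qed
  \<comment> \<open>A sequence of counterexamples whose squared distances tend to those of
    \<open>p0\<close>.\<close>
  then obtain m where m: "\<And>n. ?near (inverse (real (Suc n))) (m n)" "\<And>n. \<not> ?good (m n)"
    by metis
  have sq: "(\<lambda>n. sqd d (m n) u v) \<longlonglongrightarrow> sqd d p0 u v" if "u \<in> V" "v \<in> V" for u v
  proof (rule Lim_null[THEN iffD2], rule Lim_null_comparison)
    show "eventually (\<lambda>n. norm (sqd d (m n) u v - sqd d p0 u v) \<le> inverse (real (Suc n))) sequentially"
      using m(1) that by (intro always_eventually) (auto simp: less_imp_le)
  qed (rule LIMSEQ_inverse_real_of_nat)
  have bV: "b 0 \<in> V" "\<And>j. j < d \<Longrightarrow> b (Suc j) \<in> V" using b by auto
  have ipl: "(\<lambda>n. ip d (m n) (b 0) u v) \<longlonglongrightarrow> ip d p0 (b 0) u v" if "u \<in> V" "v \<in> V" for u v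
    unfolding ip_sqd using that bV by (intro tendsto_intros sq) auto
  define f where "f n j c = m n (b (Suc j)) c - m n (b 0) c" for n j c
  \<comment> \<open>The defect of \<open>q0\<close> as an affine dependency of \<open>m n\<close>;
    \<open>y\<close> lists its inner products with the frame vectors \<open>f n j\<close>.\<close>
  define x where "x n i c = (\<Sum>v\<in>V. q0 v i * m n v c)" for n i c
  define y where "y n i j = (\<Sum>c<d. x n i c * f n j c)" for n i j
  have pp: "ip d p0 (b 0) u (b (Suc j)) = p0 u j" if "j < d" for u j
  proof -
    have "ip d p0 (b 0) u (b (Suc j)) = (\<Sum>c<d. if c = j then p0 u c else 0)"
      unfolding ip_def by (intro sum.cong) (auto simp: p0 that)
    then show ?thesis using that by simp
  qed
  \<comment> \<open>Near-orthonormality of the frame, which holds eventually because the Gram matrix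
    converges to that of \<open>p0\<close>.\<close>
  define G where "G n \<longleftrightarrow> (\<forall>i\<in>{..<d}. \<forall>j\<in>{..<d}. \<bar>(\<Sum>c<d. f n i c * f n j c) - (if i = j then 1 else 0)\<bar> \<le> 1 / (2 * real d))"
    for n
  have "eventually G sequentially"
    unfolding G_def
  proof (intro eventually_ball_finite ballI)
    fix i j assume ij: "i \<in> {..<d}" "j \<in> {..<d}"
    have "(\<Sum>c<d. f n i c * f n j c) = ip d (m n) (b 0) (b (Suc i)) (b (Suc j))" for n
      by (simp add: ip_def f_def)
    then have "(\<lambda>n. (\<Sum>c<d. f n i c * f n j c) - (if i = j then 1 else 0)) \<longlonglongrightarrow> ip d p0 (b 0) (b (Suc i)) (b (Suc j)) - (if i = j then 1 else 0)"
      using ij bV by (simp only:) (intro tendsto_diff tendsto_const ipl, auto)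
    moreover have "ip d p0 (b 0) (b (Suc i)) (b (Suc j)) = (if i = j then 1 else 0)"
      using ij by (simp add: pp p0)
    ultimately have "(\<lambda>n. (\<Sum>c<d. f n i c * f n j c) - (if i = j then 1 else 0)) \<longlonglongrightarrow> 0" by simp
    moreover have "1 / (2 * real d) > 0" using ij by simp
    ultimately have "eventually (\<lambda>n. dist ((\<Sum>c<d. f n i c * f n j c) - (if i = j then 1 else 0)) 0 < 1 / (2 * real d)) sequentially"
      by (rule tendstoD)
    then show "eventually (\<lambda>n. \<bar>(\<Sum>c<d. f n i c * f n j c) - (if i = j then 1 else 0)\<bar> \<le> 1 / (2 * real d)) sequentially"
      by eventually_elim (simp add: dist_real_def)
  qed auto
  moreover define P where "P n i \<mu> \<longleftrightarrow> (\<forall>c<d. (\<Sum>j<d. \<mu> j * f n j c) = x n i c) \<and> (\<forall>j<d. \<bar>\<mu> j\<bar> \<le> 2 * (\<Sum>j<d. \<bar>y n i j\<bar>))"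
    for n i \<mu>
  have "\<exists>\<mu>. G n \<longrightarrow> P n i \<mu>" for n i
  proof (cases "G n")
    case True
    then have "\<exists>\<mu>. P n i \<mu>"
      unfolding P_def y_def G_def by (intro frame_coordinates) blast
    then show ?thesis by blast
  qed blast
  then obtain \<mu> where \<mu>: "\<And>n i. G n \<longrightarrow> P n i (\<mu> n i)" by metis
  ultimately have ev: "eventually (\<lambda>n. \<forall>i. P n i (\<mu> n i)) sequentially"
    by (elim eventually_mono) simp
  have ylim: "(\<lambda>n. y n i j) \<longlonglongrightarrow> 0" if "i < k" "j < d" for i j
  proof -
    \<comment> \<open>Rows of \<open>q0\<close> sum to zero, so the base point can be subtracted;
      then \<open>y\<close> involves only inner products controlled by squared distances.\<close>
    have eq: "y n i j = (\<Sum>v\<in>V. q0 v i * ip d (m n) (b 0) v (b (Suc j)))" for n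
    proof -
      have "x n i c = (\<Sum>v\<in>V. q0 v i * (m n v c - m n (b 0) c))" for c
        using q0(2)[OF \<open>i < k\<close>] by (simp add: x_def right_diff_distrib sum_subtractf flip: sum_distrib_right)
      then have "y n i j = (\<Sum>c<d. \<Sum>v\<in>V. q0 v i * ((m n v c - m n (b 0) c) * f n j c))"
        by (simp add: y_def sum_distrib_right mult.assoc)
      also have "\<dots> = (\<Sum>v\<in>V. \<Sum>c<d. q0 v i * ((m n v c - m n (b 0) c) * f n j c))"
        by (rule sum.swap)
      finally show ?thesis by (simp add: ip_def f_def sum_distrib_left)
    qed
    have "(\<lambda>n. y n i j) \<longlonglongrightarrow> (\<Sum>v\<in>V. q0 v i * ip d p0 (b 0) v (b (Suc j)))"
      unfolding eq using that bV by (intro tendsto_intros ipl) auto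
    then show ?thesis using that by (simp add: pp q0)
  qed
  have \<mu>lim: "(\<lambda>n. \<mu> n i j) \<longlonglongrightarrow> 0" if "i < k" "j < d" for i j
  proof (rule Lim_null_comparison)
    show "eventually (\<lambda>n. norm (\<mu> n i j) \<le> 2 * (\<Sum>j<d. \<bar>y n i j\<bar>)) sequentially"
      using ev by eventually_elim (use that in \<open>auto simp: P_def\<close>)
    have "(\<lambda>n. 2 * (\<Sum>j<d. \<bar>y n i j\<bar>)) \<longlonglongrightarrow> 2 * (\<Sum>j<d. \<bar>0\<bar>)"
      using that by (intro tendsto_intros ylim) auto
    then show "(\<lambda>n. 2 * (\<Sum>j<d. \<bar>y n i j\<bar>)) \<longlonglongrightarrow> 0" by simp
  qed
  \<comment> \<open>A correction with total zero that changes the weighted point sum by the frame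
    vector \<open>f n j\<close>. Its multiples by the frame coordinates \<open>\<mu>\<close> of the
    defect cancel the defect exactly.\<close>
  define h where "h v j = (if v = b (Suc j) then 1 else 0) - (if v = b 0 then 1 else 0 :: real)" for v j
  define Q where "Q n v i = q0 v i - (\<Sum>j<d. \<mu> n i j * h v j)" for n v i
  have "eventually (\<lambda>n. edge_interp k F (Q n)) sequentially"
  proof (rule eventually_edge_interp[OF finF q0(1)])
    fix v i assume "i < k"
    then have "(\<lambda>n. Q n v i) \<longlonglongrightarrow> q0 v i - (\<Sum>j<d. 0 * h v j)"
      unfolding Q_def by (intro tendsto_intros \<mu>lim) auto
    then show "(\<lambda>n. Q n v i) \<longlonglongrightarrow> q0 v i" by simp
  qed
  with ev have "eventually (\<lambda>n. edge_interp k F (Q n) \<and> (\<forall>i. \<forall>c<d. (\<Sum>j<d. \<mu> n i j * f n j c) = x n i c)) sequentially"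
    by eventually_elim (auto simp: P_def)
  then obtain n where n: "edge_interp k F (Q n)" "\<And>i c. c < d \<Longrightarrow> (\<Sum>j<d. \<mu> n i j * f n j c) = x n i c"
    using eventually_sequentially by auto
  have hsum: "(\<Sum>v\<in>V. h v j * a v) = a (b (Suc j)) - a (b 0)" if "j < d" for j and a :: "'v \<Rightarrow> real"
  proof -
    have "(\<Sum>v\<in>V. h v j * a v) = (\<Sum>v\<in>V. (if v = b (Suc j) then a v else 0) - (if v = b 0 then a v else 0))"
      by (intro sum.cong) (auto simp: h_def)
    then show ?thesis using fin bV that by (simp add: sum_subtractf)
  qed
  have corr: "(\<Sum>v\<in>V. (\<Sum>j<d. \<mu> n i j * h v j) * a v) = (\<Sum>j<d. \<mu> n i j * (a (b (Suc j)) - a (b 0)))" for i a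
  proof -
    have "(\<Sum>v\<in>V. (\<Sum>j<d. \<mu> n i j * h v j) * a v) = (\<Sum>v\<in>V. \<Sum>j<d. \<mu> n i j * (h v j * a v))"
      by (simp add: sum_distrib_right mult.assoc)
    also have "\<dots> = (\<Sum>j<d. \<Sum>v\<in>V. \<mu> n i j * (h v j * a v))" by (rule sum.swap)
    also have "\<dots> = (\<Sum>j<d. \<mu> n i j * (a (b (Suc j)) - a (b 0)))"
      by (intro sum.cong refl) (simp add: hsum flip: sum_distrib_left)
    finally show ?thesis .
  qed
  have "?good (m n)"
    unfolding inf_rigid_def
  proof (intro allI impI ballI)
    fix \<delta> u v
    assume "\<forall>u\<in>V. \<forall>v\<in>V. u \<noteq> v \<longrightarrow> {u, v} \<notin> F \<longrightarrow> vdot d (m n) \<delta> u v = 0" and uv: "u \<in> V" "v \<in> V"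
    then have E: "vdot d (m n) \<delta> u v = 0" if "u \<in> V" "v \<in> V" "u \<noteq> v" "{u, v} \<notin> F" for u v
      using that by blast
    show "vdot d (m n) \<delta> u v = 0"
    proof (rule vdot_zero_of_edge_interp[OF fin F n(1) _ _ E uv])
      show "(\<Sum>v\<in>V. Q n v i) = 0" if "i < k" for i
        using corr[of i "\<lambda>_. 1"] q0(2)[OF that] by (simp add: Q_def sum_subtractf)
      show "(\<Sum>v\<in>V. Q n v i * m n v c) = 0" if "i < k" "c < d" for i c
      proof -
        have "(\<Sum>v\<in>V. Q n v i * m n v c) = x n i c - (\<Sum>v\<in>V. (\<Sum>j<d. \<mu> n i j * h v j) * m n v c)"
          by (simp add: Q_def x_def left_diff_distrib sum_subtractf)
        then show ?thesis using n(2)[OF that(2), of i] by (simp add: corr f_def)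
      qed
    qed auto
  qed
  then show False using m(2) by blast
qed

section \<open>From infinitesimal to continuous rigidity\<close>

text \<open>
  Take \<open>W\<close> with \<open>q ` W\<close> a basis and expand \<open>q v = - (\<Sum>w\<in>W. l v w q w)\<close> for \<open>v \<notin> W\<close>; scaling \<open>q w\<close>
  by the column sum \<open>t w\<close> turns \<open>l v w / t w\<close> into barycentric coordinates. A small change of
  one vector makes all \<open>t w\<close> nonzero.
\<close>
lemma exists_base_config:
  fixes V :: "'v set"
  assumes fin: "finite V" "card V = k + d + 1" and finF: "finite F"
    and F: "\<And>e. e \<in> F \<Longrightarrow> card e = 2" and FV: "\<Union>F \<subseteq> V" and q: "edge_interp k F q"
  shows "\<exists>q0 p0 b. edge_interp k F q0 \<and> gale_pair k d V q0 p0 \<and> simplex_frame d V p0 b"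
proof -
  obtain W where W: "W \<subseteq> V" "card W = k" "finite W"
    using obtain_subset_with_card_n[of k V] fin by auto
  define B where "B = V - W"
  have B: "finite B" "card B = Suc d" "V = W \<union> B" "W \<inter> B = {}"
    using fin W by (auto simp: B_def card_Diff_subset)
  obtain b where b: "bij_betw b {0..<Suc d} B"
    using ex_bij_betw_nat_finite[OF B(1)] B(2) by auto
  have bB: "b j \<in> B" if "j \<le> d" for j
    using bij_betwE[OF b] that by auto
  have b_eq: "b i = b j \<longleftrightarrow> i = j" if "i \<le> d" "j \<le> d" for i j
    using bij_betw_imp_inj_on[OF b] that by (auto simp: inj_on_def)
  obtain q1 where q1: "edge_interp k F q1" "lininterp {..<k} W q1"
    using edge_interp_perturb[OF finF q W(3)] W(2) by auto
  have sp: "lininterp W {..<k} (\<lambda>i w. q1 w i)"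
    using lininterp_spanning[OF _ W(3) _ q1(2)] W(2) by simp
  have "\<exists>l. \<forall>i\<in>{..<k}. (\<Sum>w\<in>W. l w * q1 w i) = - q1 v i" for v
    using sp unfolding lininterp_def by (rule spec)
  then obtain l where l: "\<And>v i. i < k \<Longrightarrow> (\<Sum>w\<in>W. l v w * q1 w i) = - q1 v i"
    by (metis lessThan_iff)
  define S where "S w = (\<Sum>v\<in>B. l v w)" for w
  \<comment> \<open>Subtracting this multiple of the sum over \<open>W\<close> adds the same small
    number to every expansion coefficient of \<open>b 0\<close>, hence to every column sum
    \<open>S w\<close>.\<close>
  define Q where "Q n v i = (if v = b 0 then q1 v i - inverse (real (Suc n)) * (\<Sum>w\<in>W. q1 w i) else q1 v i)"
    for n v i
  have "eventually (\<lambda>n. edge_interp k F (Q n)) sequentially"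
  proof (rule eventually_edge_interp[OF finF q1(1)])
    fix v i
    show "(\<lambda>n. Q n v i) \<longlonglongrightarrow> q1 v i"
    proof (cases "v = b 0")
      case True
      have "(\<lambda>n. q1 v i - inverse (real (Suc n)) * (\<Sum>w\<in>W. q1 w i)) \<longlonglongrightarrow> q1 v i - 0 * (\<Sum>w\<in>W. q1 w i)"
        by (intro tendsto_intros LIMSEQ_inverse_real_of_nat)
      then show ?thesis using True by (simp add: Q_def)
    qed (simp add: Q_def)
  qed
  moreover have "eventually (\<lambda>n. \<forall>w\<in>W. S w + inverse (real (Suc n)) \<noteq> 0) sequentially"
  proof (intro eventually_ball_finite[OF W(3)] ballI)
    fix w
    show "eventually (\<lambda>n. S w + inverse (real (Suc n)) \<noteq> 0) sequentially"
    proof (cases "S w = 0")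
      case True
      then show ?thesis by simp
    next
      case False
      have "(\<lambda>n. S w + inverse (real (Suc n))) \<longlonglongrightarrow> S w + 0"
        by (intro tendsto_intros LIMSEQ_inverse_real_of_nat)
      then show ?thesis using False by (intro tendsto_imp_eventually_ne) auto
    qed
  qed
  ultimately have "eventually (\<lambda>n. edge_interp k F (Q n) \<and> (\<forall>w\<in>W. S w + inverse (real (Suc n)) \<noteq> 0)) sequentially"
    by (rule eventually_conj)
  then obtain n where n: "edge_interp k F (Q n)" "\<And>w. w \<in> W \<Longrightarrow> S w + inverse (real (Suc n)) \<noteq> 0"
    using eventually_sequentially by auto
  define \<eta> where "\<eta> = inverse (real (Suc n))"
  define q2 where "q2 = Q n"
  define l2 where "l2 v w = l v w + (if v = b 0 then \<eta> else 0)" for v w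
  define t where "t w = S w + \<eta>" for w
  have t0: "t w \<noteq> 0" if "w \<in> W" for w using n(2)[OF that] by (simp add: t_def \<eta>_def)
  have b0: "b 0 \<in> B" using bB by simp
  have t: "t w = (\<Sum>v\<in>B. l2 v w)" for w
    using B(1) b0 by (simp add: t_def S_def l2_def sum.distrib)
  have q2W: "q2 w i = q1 w i" if "w \<in> W" for w i
    using that b0 B(4) by (auto simp: q2_def Q_def)
  have l2: "(\<Sum>w\<in>W. l2 v w * q1 w i) = - q2 v i" if "i < k" for v i
  proof (cases "v = b 0")
    case True
    then have "(\<Sum>w\<in>W. l2 v w * q1 w i) = (\<Sum>w\<in>W. l v w * q1 w i) + \<eta> * (\<Sum>w\<in>W. q1 w i)"
      by (simp add: l2_def distrib_right sum.distrib sum_distrib_left)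
    then show ?thesis using l[OF that] True by (simp add: q2_def Q_def \<eta>_def)
  next
    case False
    then show ?thesis using l[OF that] by (simp add: l2_def q2_def Q_def)
  qed
  define s where "s v = (if v \<in> W then t v else 1)" for v
  define q0 where "q0 v i = s v * q2 v i" for v i
  \<comment> \<open>Coordinate \<open>c\<close> of a point of \<open>W\<close> is its barycentric
    weight at \<open>b (Suc c)\<close>; the points of \<open>B\<close> form the standard simplex
    with \<open>b 0\<close> at the origin.\<close>
  define p0 where "p0 v c = (if v \<in> W then l2 (b (Suc c)) v / t v else if v = b (Suc c) then 1 else 0)" for v c
  have split: "(\<Sum>v\<in>V. g v) = (\<Sum>v\<in>W. g v) + (\<Sum>v\<in>B. g v)" for g :: "'v \<Rightarrow> real"
    using B W(3) by (simp add: sum.union_disjoint)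
  have notW: "v \<notin> W" if "v \<in> B" for v using that B(4) by blast
  have "edge_interp k F q0"
    unfolding q0_def
    by (rule edge_interp_scale) (use n(1) F t0 in \<open>auto simp: q2_def s_def\<close>)
  moreover have "(\<Sum>v\<in>V. q0 v i) = 0" if "i < k" for i
  proof -
    have "(\<Sum>w\<in>W. q0 w i) = (\<Sum>w\<in>W. \<Sum>v\<in>B. l2 v w * q1 w i)"
      by (intro sum.cong) (auto simp: q0_def s_def q2W t sum_distrib_right)
    also have "\<dots> = (\<Sum>v\<in>B. - q2 v i)"
      by (subst sum.swap) (simp add: l2[OF that])
    also have "\<dots> = - (\<Sum>v\<in>B. q0 v i)"
      unfolding sum_negf[symmetric] by (intro sum.cong) (auto simp: q0_def s_def notW)
    finally show ?thesis by (simp add: split)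
  qed
  moreover have "(\<Sum>v\<in>V. q0 v i * p0 v c) = 0" if "i < k" "c < d" for i c
  proof -
    have "(\<Sum>w\<in>W. q0 w i * p0 w c) = (\<Sum>w\<in>W. l2 (b (Suc c)) w * q1 w i)"
      by (intro sum.cong) (auto simp: q0_def s_def q2W p0_def t0)
    moreover have "(\<Sum>v\<in>B. q0 v i * p0 v c) = (\<Sum>v\<in>B. if v = b (Suc c) then q2 v i else 0)"
      by (intro sum.cong) (auto simp: q0_def s_def p0_def notW)
    ultimately show ?thesis using that B(1) bB[of "Suc c"] by (simp add: split l2)
  qed
  moreover have "\<forall>j\<le>d. b j \<in> V" using bB B(3) by blast
  moreover have "p0 (b 0) c = 0" if "c < d" for c
    using notW[OF b0] b_eq[of 0 "Suc c"] that by (simp add: p0_def)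
  moreover have "p0 (b (Suc j)) c = (if c = j then 1 else 0)" if "j < d" "c < d" for j c
    using notW[OF bB, of "Suc j"] b_eq[of "Suc j" "Suc c"] that by (auto simp: p0_def)
  ultimately have "edge_interp k F q0 \<and> gale_pair k d V q0 p0 \<and> simplex_frame d V p0 b"
    by (simp add: gale_pair_def simplex_frame_def)
  then show ?thesis by blast
qed

section \<open>Continuous motions and generic configurations\<close>

lemma edist_eq_iff: "edist d (p u) (p v) = edist d (p' u) (p' v) \<longleftrightarrow> sqd d p u v = sqd d p' u v"
  by (simp add: edist_def L2_set_def sqd_def)

text \<open>Difference of squares. It turns equality of lengths in two configurations into a linear
  condition at their midpoint.\<close>

lemma vdot_midpoint:
  "vdot d (\<lambda>v c. (p v c + p' v c) / 2) (\<lambda>v c. p v c - p' v c) u v = (sqd d p u v - sqd d p' u v) / 2"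
proof -
  have "2 * vdot d (\<lambda>v c. (p v c + p' v c) / 2) (\<lambda>v c. p v c - p' v c) u v
    = (\<Sum>c<d. (p u c - p v c)\<^sup>2 - (p' u c - p' v c)\<^sup>2)"
    unfolding vdot_def sum_distrib_left by (intro sum.cong) (auto simp: power2_eq_square field_simps)
  then show ?thesis by (simp add: sqd_def sum_subtractf)
qed

text \<open>The times at which all distances agree with the initial ones form a nonempty open and
  closed subset of the connected interval.\<close>

lemma rigid_of_inf_rigid_near:
  fixes p0 :: "'v config"
  assumes G: "finite (verts G)"
    and good: "\<And>m. (\<forall>u\<in>verts G. \<forall>v\<in>verts G. \<bar>sqd d m u v - sqd d p0 u v\<bar> < e) \<Longrightarrow> inf_rigid d (verts G) F m"
    and F: "\<And>u v. u \<in> verts G \<Longrightarrow> v \<in> verts G \<Longrightarrow> u \<noteq> v \<Longrightarrow> {u, v} \<notin> F \<Longrightarrow> {u, v} \<in> edges G"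
    and p: "\<And>u v. u \<in> verts G \<Longrightarrow> v \<in> verts G \<Longrightarrow> \<bar>sqd d p u v - sqd d p0 u v\<bar> < e"
  shows "rigid d G p"
  unfolding rigid_def edist_eq_iff
proof (intro allI impI, elim conjE)
  fix q
  assume mot: "continuous_motion d G p q"
    and edges: "\<forall>t\<in>{0..1}. \<forall>u v. {u, v} \<in> edges G \<longrightarrow> sqd d (q t) u v = sqd d p u v"
  let ?V = "verts G"
  have cont: "continuous_on {0..1} (\<lambda>t. q t v i)" if "v \<in> ?V" "i < d" for v i
    using mot that by (auto simp: continuous_motion_def)
  have q0: "q 0 v i = p v i" if "v \<in> ?V" "i < d" for v i
    using mot that by (auto simp: continuous_motion_def)
  define T where "T = {t \<in> {0..1}. \<forall>u\<in>?V. \<forall>v\<in>?V. sqd d (q t) u v = sqd d p u v}"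
  have csqd: "continuous_on {0..1} (\<lambda>t. sqd d (q t) u v)" if "u \<in> ?V" "v \<in> ?V" for u v
    unfolding sqd_def using that by (intro continuous_intros cont) auto
  have T0: "0 \<in> T" using q0 by (auto simp: T_def sqd_def)
  have closed: "closed T"
  proof -
    have "T = {0..1} \<inter> (\<Inter>u\<in>?V. \<Inter>v\<in>?V. {t \<in> {0..1}. sqd d (q t) u v = sqd d p u v})"
      by (auto simp: T_def)
    moreover have "closed {t \<in> {0..1::real}. sqd d (q t) u v = sqd d p u v}" if "u \<in> ?V" "v \<in> ?V" for u v
      using continuous_closed_preimage_constant[OF csqd[OF that]] by simp
    ultimately show ?thesis by (auto intro!: closed_Int closed_INT)
  qed
  have opn: "\<exists>r>0. \<forall>t'\<in>{0..1}. dist t' t < r \<longrightarrow> t' \<in> T" if t: "t \<in> T" for t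
  proof -
    \<comment> \<open>At \<open>s = t\<close> the midpoint is \<open>q t\<close>, whose distances
      are those of \<open>p\<close>; for nearby \<open>s\<close> it stays in the infinitesimally
      rigid neighbourhood.\<close>
    define m where "m s = (\<lambda>v c. (q s v c + q t v c) / 2)" for s
    have t01: "t \<in> {0..1}" using t by (simp add: T_def)
    have "((\<lambda>s. \<bar>sqd d (m s) u v - sqd d p0 u v\<bar>) \<longlongrightarrow> \<bar>sqd d (m t) u v - sqd d p0 u v\<bar>) (at t within {0..1})"
      if "u \<in> ?V" "v \<in> ?V" for u v
    proof -
      have "continuous_on {0..1} (\<lambda>s. \<bar>sqd d (m s) u v - sqd d p0 u v\<bar>)"
        unfolding sqd_def m_def using that by (intro continuous_intros cont) auto
      then show ?thesis using t01 by (simp add: continuous_on_def)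
    qed
    moreover have "m t = q t" by (simp add: m_def)
    ultimately have "eventually (\<lambda>s. \<bar>sqd d (m s) u v - sqd d p0 u v\<bar> < e) (at t within {0..1})"
      if "u \<in> ?V" "v \<in> ?V" for u v
      using that p[OF that] t by (intro order_tendstoD(2)[where y = "\<bar>sqd d (m t) u v - sqd d p0 u v\<bar>"]) (auto simp: T_def)
    then have "eventually (\<lambda>s. \<forall>u\<in>?V. \<forall>v\<in>?V. \<bar>sqd d (m s) u v - sqd d p0 u v\<bar> < e) (at t within {0..1})"
      using G by (simp add: eventually_ball_finite)
    then obtain r where r: "r > 0" "\<And>s. s \<in> {0..1} \<Longrightarrow> s \<noteq> t \<Longrightarrow> dist s t < r \<Longrightarrow>
        \<forall>u\<in>?V. \<forall>v\<in>?V. \<bar>sqd d (m s) u v - sqd d p0 u v\<bar> < e"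
      unfolding eventually_at by blast
    have "s \<in> T" if s: "s \<in> {0..1}" "dist s t < r" for s
    proof (cases "s = t")
      case False
      have "inf_rigid d ?V F (m s)"
        by (rule good) (rule r(2)[OF s(1) False s(2)])
      moreover have "vdot d (m s) (\<lambda>v c. q s v c - q t v c) u v = 0"
        if "u \<in> ?V" "v \<in> ?V" "u \<noteq> v" "{u, v} \<notin> F" for u v
        using edges s(1) t01 F[OF that] unfolding m_def vdot_midpoint by simp
      ultimately have "\<forall>u\<in>?V. \<forall>v\<in>?V. vdot d (m s) (\<lambda>v c. q s v c - q t v c) u v = 0"
        unfolding inf_rigid_def by blast
      then have "sqd d (q s) u v = sqd d (q t) u v" if "u \<in> ?V" "v \<in> ?V" for u v
        using that unfolding m_def vdot_midpoint by auto
      then show ?thesis using t s by (simp add: T_def)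
    qed (use t in simp)
    then show ?thesis using r(1) by blast
  qed
  have "T \<subseteq> {0..1}" by (auto simp: T_def)
  then have "openin (top_of_set {0..1}) T" "closedin (top_of_set {0..1}) T"
    using opn closed by (auto simp: openin_euclidean_subtopology_iff closed_subset)
  then have "T = {0..1}"
    using T0 connected_clopen[of "{0..1::real}"] by auto
  then show "\<forall>t\<in>{0..1}. \<forall>u\<in>?V. \<forall>v\<in>?V. sqd d (q t) u v = sqd d p u v"
    by (auto simp: T_def)
qed

lemma exists_generic_near:
  assumes "finite (verts G)" "e > 0"
  shows "\<exists>p. generic d G p \<and> (\<forall>u\<in>verts G. \<forall>v\<in>verts G. \<bar>sqd d p u v - sqd d p0 u v\<bar> < e)"
proof -
  have "\<exists>x. alg_independent (verts G \<times> {..<d}) x \<and>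
      (\<forall>i\<in>verts G \<times> {..<d}. \<bar>x i - (case i of (v, c) \<Rightarrow> p0 v c)\<bar> < inverse (real (Suc n)))" for n
    using assms(1) by (intro alg_independent_dense) auto
  then obtain x where x: "\<And>n. alg_independent (verts G \<times> {..<d}) (x n)"
    "\<And>n i. i \<in> verts G \<times> {..<d} \<Longrightarrow> \<bar>x n i - (case i of (v, c) \<Rightarrow> p0 v c)\<bar> < inverse (real (Suc n))"
    by metis
  have lim: "(\<lambda>n. x n (v, c)) \<longlonglongrightarrow> p0 v c" if "v \<in> verts G" "c < d" for v c
  proof (rule Lim_null[THEN iffD2], rule Lim_null_comparison)
    show "eventually (\<lambda>n. norm (x n (v, c) - p0 v c) \<le> inverse (real (Suc n))) sequentially"
    proof (intro always_eventually allI)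
      fix n show "norm (x n (v, c) - p0 v c) \<le> inverse (real (Suc n))"
        using x(2)[of "(v, c)" n] that by simp
    qed
  qed (rule LIMSEQ_inverse_real_of_nat)
  have "eventually (\<lambda>n. \<forall>u\<in>verts G. \<forall>v\<in>verts G. \<bar>sqd d (\<lambda>v c. x n (v, c)) u v - sqd d p0 u v\<bar> < e) sequentially"
  proof (intro eventually_ball_finite ballI assms)
    fix u v assume "u \<in> verts G" "v \<in> verts G"
    then have "(\<lambda>n. sqd d (\<lambda>v c. x n (v, c)) u v) \<longlonglongrightarrow> sqd d p0 u v"
      unfolding sqd_def by (intro tendsto_intros lim) auto
    then have "eventually (\<lambda>n. dist (sqd d (\<lambda>v c. x n (v, c)) u v) (sqd d p0 u v) < e) sequentially"
      using assms(2) by (rule tendstoD)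
    then show "eventually (\<lambda>n. \<bar>sqd d (\<lambda>v c. x n (v, c)) u v - sqd d p0 u v\<bar> < e) sequentially"
      by (simp add: dist_real_def)
  qed
  then obtain n where "\<forall>u\<in>verts G. \<forall>v\<in>verts G. \<bar>sqd d (\<lambda>v c. x n (v, c)) u v - sqd d p0 u v\<bar> < e"
    using eventually_sequentially by auto
  moreover have "generic d G (\<lambda>v c. x n (v, c))"
    using x(1) by (simp add: generic_def)
  ultimately show ?thesis by blast
qed

lemma edges_complement:
  "edges (complement G) = {e. e \<subseteq> verts G \<and> card e = 2} - edges G"
proof (intro subset_antisym subsetI)
  fix e assume "e \<in> edges (complement G)"
  then obtain u v where "e = {u, v}" "u \<in> verts G" "v \<in> verts G" "u \<noteq> v" "{u, v} \<notin> edges G"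
    unfolding complement_def by auto
  then show "e \<in> {e. e \<subseteq> verts G \<and> card e = 2} - edges G" by simp
next
  fix e assume e: "e \<in> {e. e \<subseteq> verts G \<and> card e = 2} - edges G"
  then have "card e = 2" by simp
  then obtain u v where "e = {u, v}" "u \<noteq> v" unfolding card_2_iff by blast
  then have "e = {u, v} \<and> u \<in> verts G \<and> v \<in> verts G \<and> u \<noteq> v \<and> {u, v} \<notin> edges G"
    using e by simp
  then show "e \<in> edges (complement G)"
    unfolding complement_def sgraph.select_convs mem_Collect_eq by blast
qed

text \<open>The base configuration \<open>p0\<close> is special, but the neighbourhood of
  infinitesimally rigid configurations around it contains a generic one.\<close>

lemma generically_rigid_of_edge_interp:
  fixes G :: "'v sgraph"
  assumes G: "simple_graph G" and card: "card (verts G) = k + d + 1"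
    and q: "edge_interp k (edges (complement G)) q"
  shows "generically_rigid d G"
proof -
  let ?F = "edges (complement G)"
  have fin: "finite (verts G)" using G by (simp add: simple_graph_def)
  have "?F \<subseteq> Pow (verts G)" by (auto simp: edges_complement)
  then have finF: "finite ?F" by (rule finite_subset) (use fin in simp)
  have two: "card e = 2" if "e \<in> ?F" for e using that by (simp add: edges_complement)
  have FV: "\<Union>?F \<subseteq> verts G" by (auto simp: edges_complement)
  have "\<exists>q0 p0 b. edge_interp k ?F q0 \<and> gale_pair k d (verts G) q0 p0 \<and> simplex_frame d (verts G) p0 b"
    by (rule exists_base_config[OF fin card finF _ FV q]) (rule two)
  then obtain q0 p0 b where base: "edge_interp k ?F q0" "gale_pair k d (verts G) q0 p0"
    "simplex_frame d (verts G) p0 b" by blast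
  have "\<exists>e>0. \<forall>m. (\<forall>u\<in>verts G. \<forall>v\<in>verts G. \<bar>sqd d m u v - sqd d p0 u v\<bar> < e) \<longrightarrow> inf_rigid d (verts G) ?F m"
    by (rule inf_rigid_near[OF fin finF _ base]) (rule two)
  then obtain e where e: "e > 0"
    "\<And>m. \<forall>u\<in>verts G. \<forall>v\<in>verts G. \<bar>sqd d m u v - sqd d p0 u v\<bar> < e \<Longrightarrow> inf_rigid d (verts G) ?F m"
    by blast
  obtain p where p: "generic d G p" "\<forall>u\<in>verts G. \<forall>v\<in>verts G. \<bar>sqd d p u v - sqd d p0 u v\<bar> < e"
    using exists_generic_near[OF fin e(1)] by blast
  have "rigid d G p"
  proof (rule rigid_of_inf_rigid_near[OF fin e(2)])
    show "{u, v} \<in> edges G" if "u \<in> verts G" "v \<in> verts G" "u \<noteq> v" "{u, v} \<notin> ?F" for u v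
      using that by (simp add: edges_complement)
  qed (use p in auto)
  then show ?thesis using p(1) by (auto simp: generically_rigid_def)
qed

section \<open>The complement graph\<close>

lemma card_edges_at_complement:
  assumes G: "simple_graph G" and v: "v \<in> verts G"
  shows "card (edges_at (edges (complement G)) v) + degree G v = card (verts G) - 1"
proof -
  let ?N = "{e. e \<subseteq> verts G \<and> card e = 2 \<and> v \<in> e}"
  have fin: "finite (verts G)" using G by (simp add: simple_graph_def)
  have "?N = (\<lambda>w. {v, w}) ` (verts G - {v})"
  proof (intro subset_antisym subsetI)
    fix e assume e: "e \<in> ?N"
    then have "card e = 2" by simp
    then obtain x y where xy: "e = {x, y}" "x \<noteq> y" unfolding card_2_iff by blast
    then show "e \<in> (\<lambda>w. {v, w}) ` (verts G - {v})"
      using e by (cases "x = v") (auto simp: insert_commute)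
  qed (use v in auto)
  moreover have "inj_on (\<lambda>w. {v, w}) (verts G - {v})"
    by (auto simp: inj_on_def doubleton_eq_iff)
  ultimately have cN: "card ?N = card (verts G) - 1" using v fin by (simp add: card_image)
  have finN: "finite ?N" by (rule finite_subset[of _ "Pow (verts G)"]) (use fin in auto)
  have eq: "?N = edges_at (edges (complement G)) v \<union> {e \<in> edges G. v \<in> e}"
    using G by (auto simp: edges_at_def edges_complement simple_graph_def)
  have "edges_at (edges (complement G)) v \<inter> {e \<in> edges G. v \<in> e} = {}"
    by (auto simp: edges_at_def edges_complement)
  then have "card ?N = card (edges_at (edges (complement G)) v) + card {e \<in> edges G. v \<in> e}"
    using finN unfolding eq by (intro card_Un_disjoint) auto
  then show ?thesis using cN by (simp add: degree_def)
qed

lemma max_degree_two_complement: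
  assumes G: "simple_graph G" and md: "min_degree G \<ge> card (verts G) - 3"
  shows "max_degree_two (edges (complement G))"
proof
  have fin: "finite (verts G)" using G by (simp add: simple_graph_def)
  have "edges (complement G) \<subseteq> Pow (verts G)" by (auto simp: edges_complement)
  then show "finite (edges (complement G))" by (rule finite_subset) (use fin in simp)
  show "card e = 2" if "e \<in> edges (complement G)" for e
    using that by (simp add: edges_complement)
  show "card (edges_at (edges (complement G)) v) \<le> 2" for v
  proof (cases "v \<in> verts G")
    case True
    have "min_degree G \<le> degree G v" unfolding min_degree_def using fin True by simp
    then show ?thesis using card_edges_at_complement[OF G True] md by linarith
  next
    case False
    then have "edges_at (edges (complement G)) v = {}"
      by (auto simp: edges_at_def edges_complement)
    then show ?thesis by simp
  qed
qed

lemma card_edges_complement: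
  assumes G: "simple_graph G"
  shows "card (edges (complement G)) + card (edges G) = card (verts G) choose 2"
proof -
  let ?N = "{e. e \<subseteq> verts G \<and> card e = 2}"
  have fin: "finite (verts G)" using G by (simp add: simple_graph_def)
  then have cN: "card ?N = card (verts G) choose 2" by (rule n_subsets)
  have finN: "finite ?N" by (rule finite_subset[of _ "Pow (verts G)"]) (use fin in auto)
  have sub: "edges G \<subseteq> ?N" using G by (auto simp: simple_graph_def)
  have "card (edges (complement G)) = card ?N - card (edges G)"
    unfolding edges_complement by (rule card_Diff_subset[OF finite_subset[OF sub finN] sub])
  then show ?thesis using cN card_mono[OF finN sub] by simp
qed

section \<open>Triangles as components of the complement\<close>

lemma edges_cycle_graph_3: "edges (cycle_graph 3) = {{0, 1}, {1, 2}, {0, 2}}"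
proof -
  have "edges (cycle_graph 3) = (\<lambda>i. {i, Suc i mod 3}) ` {..<3}"
    by (auto simp: cycle_graph_def)
  also have "{..<3} = {0, 1, 2::nat}" by auto
  also have "(\<lambda>i. {i, Suc i mod 3}) ` {0, 1, 2::nat} = {{0, 1}, {1, 2}, {2, 0}}"
    by (simp add: numeral_2_eq_2)
  also have "{2, 0} = {0, 2::nat}" by auto
  finally show ?thesis .
qed

text \<open>If \<open>sigma\<close> is 0 then the empty set is admissible. With degrees at most two
  a triangle would be a whole component, isomorphic to the forbidden 3-cycle.\<close>

lemma triangle_free_of_sigma_0:
  assumes G: "simple_graph G" and md: "max_degree_two (edges (complement G))"
    and sigma: "sigma (complement G) = 0"
  shows "triangle_free (edges (complement G))"
proof (rule ccontr)
  define F where "F = complement G"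
  interpret max_degree_two "edges F" using md by (simp add: F_def)
  have fin: "finite (verts F)" using G by (simp add: F_def complement_def simple_graph_def)
  have FV: "e \<subseteq> verts F" if "e \<in> edges F" for e
    using that unfolding F_def edges_complement by (simp add: complement_def)
  assume "\<not> ?thesis"
  then obtain a b c where abc: "a \<noteq> b" "b \<noteq> c" "a \<noteq> c" "{a, b} \<in> edges F" "{b, c} \<in> edges F" "{a, c} \<in> edges F"
    unfolding triangle_free_def F_def by blast
  have "admissible F (verts F)"
    by (auto simp: admissible_def remove_verts_def induced_def components_def)
  then have "{card S |S. admissible F S} \<noteq> {}" by blast
  moreover have "finite {card S |S. admissible F S}"
  proof (rule finite_subset)
    show "{card S |S. admissible F S} \<subseteq> card ` Pow (verts F)" by (auto simp: admissible_def)
  qed (use fin in simp)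
  ultimately have "sigma F \<in> {card S |S. admissible F S}"
    unfolding sigma_def by (intro Min_in)
  then obtain S where S: "admissible F S" "card S = 0" using sigma by (auto simp: F_def)
  then have "finite S" using fin by (auto simp: admissible_def intro: finite_subset)
  then have "admissible F {}" using S by simp
  moreover have "remove_verts F {} = F"
  proof -
    have "edges F = {e \<in> edges F. e \<subseteq> verts F}" using FV by auto
    then show ?thesis by (simp add: remove_verts_def induced_def)
  qed
  ultimately have noC3: "\<not> isomorphic C (cycle_graph 3)" if "C \<in> components F" for C
    using that by (simp add: admissible_def)
  have a: "a \<in> verts F" using FV abc by blast
  \<comment> \<open>The two triangle edges at \<open>x\<close> exhaust its degree, so no edge leaves
    the triangle.\<close>
  have closed: "w \<in> {a, b, c}" if "x \<in> {a, b, c}" "adj F x w" for x w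
  proof -
    have E: "{x, w} \<in> edges F" using that by (simp add: adj_def)
    have tri: "w \<in> {y, z}" if "x \<noteq> y" "x \<noteq> z" "y \<noteq> z" "{x, y} \<in> edges F" "{x, z} \<in> edges F" for y z
    proof -
      have "{x, y} = {x, z} \<or> {x, y} = {x, w} \<or> {x, z} = {x, w}"
        by (rule three_edges[of _ _ _ x]) (use that E in auto)
      then show ?thesis using that by (auto simp: doubleton_eq_iff)
    qed
    show ?thesis using that(1)
    proof (elim insertE emptyE)
      assume "x = a"
      then show ?thesis using tri[of b c] abc by auto
    next
      assume "x = b"
      then show ?thesis using tri[of a c] abc by (auto simp: insert_commute)
    next
      assume "x = c"
      then show ?thesis using tri[of a b] abc by (auto simp: insert_commute)
    qed
  qed
  have reach: "{w. (adj F)\<^sup>*\<^sup>* a w} = {a, b, c}"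
  proof
    show "{w. (adj F)\<^sup>*\<^sup>* a w} \<subseteq> {a, b, c}"
    proof
      fix w assume "w \<in> {w. (adj F)\<^sup>*\<^sup>* a w}"
      then have "(adj F)\<^sup>*\<^sup>* a w" by simp
      then show "w \<in> {a, b, c}" by (induction rule: rtranclp_induct) (use closed in blast)+
    qed
    have "adj F a b" "adj F a c" using abc by (auto simp: adj_def)
    then show "{a, b, c} \<subseteq> {w. (adj F)\<^sup>*\<^sup>* a w}" by auto
  qed
  define C where "C = induced F {a, b, c}"
  have "C = induced F {w. (adj F)\<^sup>*\<^sup>* a w}" unfolding C_def reach ..
  then have "C \<in> components F" unfolding components_def using a by blast
  moreover have "isomorphic C (cycle_graph 3)"
    unfolding isomorphic_def
  proof (intro exI conjI ballI)
    define f where "f x = (if x = a then 0 else if x = b then 1 else 2 :: nat)" for x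
    have vC: "verts C = {a, b, c}"
      using FV[OF abc(4)] FV[OF abc(5)] by (auto simp: C_def induced_def)
    have f: "f a = 0" "f b = 1" "f c = 2" using abc by (auto simp: f_def)
    have "{..<3} = {0, 1, 2::nat}" by auto
    then show "bij_betw f (verts C) (verts (cycle_graph 3))"
      using abc f by (auto simp: bij_betw_def inj_on_def vC cycle_graph_def)
    fix u v assume uv: "u \<in> verts C" "v \<in> verts C"
    have single: "{x} \<notin> edges F" for x using card_edge[of "{x}"] by auto
    show "adj C u v \<longleftrightarrow> adj (cycle_graph 3) (f u) (f v)"
    proof (cases "u = v")
      case True
      then show ?thesis
        using single by (simp add: adj_def C_def induced_def edges_cycle_graph_3 singleton_insert_inj_eq') linarith
    next
      case False
      have "{u, v} \<in> edges F" "{u, v} \<subseteq> {a, b, c}"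
        using uv False abc(4-6) unfolding vC by (elim insertE emptyE; simp add: insert_commute)+
      then have "adj C u v" by (simp add: adj_def C_def induced_def)
      moreover have "adj (cycle_graph 3) (f u) (f v)"
        using uv False f unfolding vC adj_def edges_cycle_graph_3
        by (elim insertE emptyE; simp add: insert_commute)
      ultimately show ?thesis by simp
    qed
  qed
  ultimately show False using noC3 by blast
qed

section \<open>The Maxwell count and the dimension bound\<close>

text \<open>With \<open>n = M + k + 1\<close> vertices this converts the Maxwell lower bound on
  edges in dimension \<open>M\<close> into the upper bound \<open>Suc k choose 2\<close> on
  non-edges.\<close>

lemma choose_two_add:
  "((M + k + 1) choose 2) + ((M + 1) choose 2) = M * (M + k + 1) + (Suc k choose 2)"
proof (induction M)
  case 0
  then show ?case by (simp add: numeral_2_eq_2)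
next
  case (Suc M)
  have "(Suc M + k + 1) choose 2 = ((M + k + 1) choose 2) + (M + k + 1)"
    using Suc_choose_two[of "M + k + 1"] by simp
  moreover have "(Suc M + 1) choose 2 = ((M + 1) choose 2) + (M + 1)"
    using Suc_choose_two[of "M + 1"] by simp
  ultimately show ?case using Suc.IH by (simp add: algebra_simps)
qed

lemma maxwell_dim_complement:
  assumes G: "simple_graph G" and n: "card (verts G) > 0"
  obtains k where "card (verts G) = maxwell_dim G + k + 1"
    "card (edges (complement G)) \<le> Suc k choose 2"
proof -
  let ?n = "card (verts G)"
  let ?D = "{d. d \<le> ?n - 1 \<and> int d * int ?n - int ((d + 1) choose 2) \<le> int (card (edges G))}"
  have "0 \<in> ?D" by (simp add: numeral_2_eq_2)
  then have "maxwell_dim G \<in> ?D"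
    unfolding maxwell_dim_def by (intro Max_in) (auto intro: finite_subset[of _ "{..?n - 1}"])
  then have M: "maxwell_dim G \<le> ?n - 1"
    "int (maxwell_dim G) * int ?n - int ((maxwell_dim G + 1) choose 2) \<le> int (card (edges G))"
    by auto
  define k where "k = ?n - 1 - maxwell_dim G"
  have nk: "?n = maxwell_dim G + k + 1" using M(1) n by (simp add: k_def)
  have "int (maxwell_dim G * ?n) \<le> int (card (edges G) + ((maxwell_dim G + 1) choose 2))"
    using M(2) by simp
  then have "maxwell_dim G * ?n \<le> card (edges G) + ((maxwell_dim G + 1) choose 2)"
    by (simp only: of_nat_le_iff)
  moreover have "(?n choose 2) + ((maxwell_dim G + 1) choose 2) = maxwell_dim G * ?n + (Suc k choose 2)"
    using choose_two_add[of "maxwell_dim G" k] nk by simp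
  ultimately have "card (edges (complement G)) \<le> Suc k choose 2"
    using card_edges_complement[OF G] by linarith
  then show ?thesis using that nk by blast
qed

lemma rigidity_dim_ge:
  assumes "generically_rigid d G" "d \<le> card (verts G) - 1"
  shows "d \<le> rigidity_dim G"
proof -
  have "finite {d. d \<le> card (verts G) - 1 \<and> generically_rigid d G}"
    by (rule finite_subset[of _ "{..card (verts G) - 1}"]) auto
  then show ?thesis unfolding rigidity_dim_def using assms by (simp add: Max_ge)
qed

theorem corollary1p5:
  fixes G :: "'a sgraph" and n :: nat
  assumes "simple_graph G"
    and "card (verts G) = n"
    and "n \<ge> 4"
    and "min_degree G \<ge> n - 3"
  shows "int (rigidity_dim G) \<ge> int (maxwell_dim G) - \<lceil>real (sigma (complement G)) / 2\<rceil>"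
proof -
  note G = assms(1)
  have md: "max_degree_two (edges (complement G))"
    using max_degree_two_complement[OF G] assms by simp
  obtain k where k: "card (verts G) = maxwell_dim G + k + 1"
    "card (edges (complement G)) \<le> Suc k choose 2"
    using maxwell_dim_complement[OF G] assms by auto
  show ?thesis
  proof (cases "sigma (complement G) = 0")
    case True
    obtain q where q: "edge_interp k (edges (complement G)) q"
      using exists_edge_interp_tight[OF md triangle_free_of_sigma_0[OF G md True] k(2)] by blast
    have "generically_rigid (maxwell_dim G) G"
      by (rule generically_rigid_of_edge_interp[OF G _ q]) (use k in simp)
    then have "maxwell_dim G \<le> rigidity_dim G"
      by (rule rigidity_dim_ge) (use k in simp)
    then show ?thesis using True by simp
  next
    case False
    \<comment> \<open>Giving up one dimension raises the Gale dimension to \<open>Suc k\<close>;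
      this loss is covered because the ceiling is at least 1 for positive
      \<open>sigma\<close>.\<close>
    have "maxwell_dim G \<le> rigidity_dim G + 1"
    proof (cases "maxwell_dim G")
      case (Suc M)
      obtain q where q: "edge_interp (Suc k) (edges (complement G)) q"
        using exists_edge_interp_slack[OF md k(2)] by blast
      have "generically_rigid M G"
        by (rule generically_rigid_of_edge_interp[OF G _ q]) (use k Suc in simp)
      then have "M \<le> rigidity_dim G"
        by (rule rigidity_dim_ge) (use k Suc in simp)
      then show ?thesis using Suc by simp
    qed simp
    moreover have "\<lceil>real (sigma (complement G)) / 2\<rceil> \<ge> 1"
      using False by (simp add: one_le_ceiling)
    ultimately show ?thesis by linarith
  qed
qed

end
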